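(* Let $\mathcal{M}\subset\mathbb{R}^2$ be a convex body whose support function has the Fourier decomposition $h(\theta,\mathcal{M})=\sum_{n=-\infty}^\infty c_ne^{in\theta}$. Then for all $\theta$ $$Ex(\theta,\mathcal{M})=2\pi\sum_{n=-\infty}^\infty(1-n^2)\big(1+(-1)^n\cos(n\theta)\big)|c_n|^2 .$$
   Context: A convex body is a non-empty compact convex subset of $\mathbb{R}^2$. Its support function is $h(\theta,\mathcal{M})=\max_{x\in\mathcal{M}}u_\theta\cdot x$, where $u_\theta=(\cos\theta,\sin\theta)$, and $c_n=\frac{1}{2\pi}\int_{-\pi}^{\pi}h(\theta,\mathcal{M})e^{-in\theta}\,d\theta$. The excluded area function is $Ex(\theta,\mathcal{M})=|\mathcal{M}-R_\theta\mathcal{M}|$, where $R_\theta$ is the counterclockwise rotation by $\theta$, $A-B=\{a-b:a\in A,b\in B\}$ and $|\cdot|$ is area. *)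

theory Defs
  imports "HOL-Analysis.Analysis"
begin

definition convex_body :: "(real^2) set \<Rightarrow> bool" where
  "convex_body M \<longleftrightarrow> M \<noteq> {} \<and> compact M \<and> convex M"

definition unit_dir :: "real \<Rightarrow> real^2" where
  "unit_dir \<theta> = vector [cos \<theta>, sin \<theta>]"

(* For nonempty compact M the supremum is attained, so this is the maximum. *)
definition supp_fun :: "real \<Rightarrow> (real^2) set \<Rightarrow> real" where
  "supp_fun \<theta> M = (SUP x\<in>M. unit_dir \<theta> \<bullet> x)"

definition supp_coeff :: "(real^2) set \<Rightarrow> int \<Rightarrow> complex" where
  "supp_coeff M n = 1 / (2 * of_real pi) *
     integral {-pi..pi} (\<lambda>\<theta>. of_real (supp_fun \<theta> M) * exp (- \<i> * of_int n * of_real \<theta>))"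

definition rot :: "real \<Rightarrow> real^2 \<Rightarrow> real^2" where
  "rot \<theta> x = vector [vector [cos \<theta>, - sin \<theta>], vector [sin \<theta>, cos \<theta>]] *v x"

(* The infix minus on sets is set-theoretic difference, hence a separate name. *)
definition minkowski_diff :: "(real^2) set \<Rightarrow> (real^2) set \<Rightarrow> (real^2) set" where
  "minkowski_diff A B = {a - b | a b. a \<in> A \<and> b \<in> B}"

definition excluded_area :: "real \<Rightarrow> (real^2) set \<Rightarrow> real" where
  "excluded_area \<theta> M = measure lebesgue (minkowski_diff M (rot \<theta> ` M))"

end

theory Submission
  imports Defs
begin

text \<open>
  The excluded body \<open>K = M - rot \<theta> M\<close> is itself convex, with support function
  \<open>h\<^sub>K \<phi> = h \<phi> + h (\<phi> + \<pi> - \<theta>)\<close>, so \<open>\<bar>c\<^sub>n(K)\<bar>\<^sup>2 = 2 (1 + (-1)\<^sup>n cos (n \<theta>)) \<bar>c\<^sub>n\<bar>\<^sup>2\<close> and no mixed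
  areas are needed: it suffices that \<open>area K = \<pi> \<Sum> (1 - n\<^sup>2) \<bar>c\<^sub>n(K)\<bar>\<^sup>2\<close> for every convex body.
  To avoid differentiating \<open>h\<close>, circumscribe \<open>K\<close> by the \<open>2 m\<close>-gon with normals at the angles
  \<open>\<phi> + k t\<close>, \<open>t = \<pi> / m\<close>. Its area is an explicit quadratic expression in the values
  \<open>h (\<phi> + k t)\<close> and tends to \<open>area K\<close> uniformly in \<open>\<phi>\<close>. Averaging over \<open>\<phi>\<close> and applying
  Parseval's identity turns it into \<open>2 \<pi> / (t sin t) \<Sum> (cos (n t) - cos t) \<bar>c\<^sub>n\<bar>\<^sup>2\<close>, and \<open>t \<rightarrow> 0\<close>
  gives the formula.
\<close>

section \<open>Fourier coefficients and Parseval's identity\<close>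

text \<open>For smooth h the factor 1 - n^2 comes at once from half the integral of h (h + h''), but
  a support function is in general only Lipschitz: for a polygon h'' is a measure. The polygon area
  replaces h'' by a second difference, which makes sense for every h. One polygon samples h at
  finitely many angles, which the |c_n| do not control; the average over \<phi> is a combination of
  autocorrelations of h at the lags t, -t and 0, and these depend on |c_n|^2 alone. Two obstacles
  shape the rest. Cutting a polygon into triangles with apex at the origin requires positive support
  numbers; hence the body is translated so as to contain the origin, and enlarged by some \<epsilon>
  > 0 that is sent to 0 while the polygon is kept fixed. And t \<rightarrow> 0 has to be exchanged
  with an infinite sum; this works because 2 (1 - cos (n t)) / t^2 is nonnegative, lies below n^2
  and tends to n^2.\<close>

definition expi :: "int \<Rightarrow> real \<Rightarrow> complex" where
  "expi n x = exp (\<i> * of_int n * of_real x)"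

definition fourier_coeff :: "(real \<Rightarrow> complex) \<Rightarrow> int \<Rightarrow> complex" where
  "fourier_coeff f n = 1 / (2 * of_real pi) * integral {-pi..pi} (\<lambda>x. f x * expi (- n) x)"

lemma expi_add: "expi m x * expi n x = expi (m + n) x"
  by (simp add: expi_def exp_add [symmetric] algebra_simps)

lemma expi_0 [simp]: "expi 0 x = 1"
  by (simp add: expi_def)

lemma cnj_expi: "cnj (expi n x) = expi (- n) x"
  by (simp add: expi_def exp_cnj)

lemma expi_shift: "expi n (x + a) = expi n x * expi n a"
  by (simp add: expi_def exp_add [symmetric] algebra_simps)

lemma expi_cis: "expi n x = cis (of_int n * x)"
  by (simp add: expi_def cis_conv_exp algebra_simps)

lemma expi_2pi: "expi n (2 * pi) = 1"
  using cis_multiple_2pi [of "of_int n"] by (simp add: expi_cis ac_simps)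

lemma expi_periodic: "expi n (x + 2 * pi) = expi n x"
  by (simp add: expi_shift expi_2pi)

lemma continuous_on_expi [continuous_intros]: "continuous_on S (expi n)"
  unfolding expi_def by (intro continuous_intros)

lemma continuous_on_expi' [continuous_intros]:
  "continuous_on S g \<Longrightarrow> continuous_on S (\<lambda>x. expi n (g x))"
  unfolding expi_def by (intro continuous_intros)

lemma integral_expi: "integral {-pi..pi} (expi n) = (if n = 0 then 2 * of_real pi else 0)"
proof (cases "n = 0")
  case True
  then have "expi n = (\<lambda>x. 1)" by auto
  then show ?thesis using True by (simp add: scaleR_conv_of_real)
next
  case False
  define F where "F = (\<lambda>x. expi n x / (\<i> * of_int n))"
  have "(F has_vector_derivative expi n x) (at x within {-pi..pi})" for x
  proof -
    have "((\<lambda>z. exp (\<i> * of_int n * z) / (\<i> * of_int n)) has_field_derivative expi n x)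
           (at (of_real x))"
      unfolding expi_def by (rule derivative_eq_intros refl | use False in simp)+
    then show ?thesis unfolding F_def expi_def
      by (rule has_vector_derivative_real_field)
  qed
  then have "(expi n has_integral F pi - F (-pi)) {-pi..pi}"
    by (intro fundamental_theorem_of_calculus) auto
  moreover have "F pi = F (-pi)"
    using expi_periodic [of n "-pi"] by (simp add: F_def)
  ultimately show ?thesis using False by (auto simp: integral_unique)
qed

lemma integrable_expi_mult:
  assumes "continuous_on {-pi..pi} f"
  shows "(\<lambda>x. f x * expi n x) integrable_on {-pi..pi}"
  by (intro integrable_continuous_interval continuous_intros assms)

definition trig_sum :: "int set \<Rightarrow> (int \<Rightarrow> complex) \<Rightarrow> real \<Rightarrow> complex" where
  "trig_sum A a x = (\<Sum>n\<in>A. a n * expi n x)"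

lemma continuous_on_trig_sum [continuous_intros]: "continuous_on S (trig_sum A a)"
  unfolding trig_sum_def by (intro continuous_intros)

lemma fourier_coeff_trig_sum:
  assumes "finite A"
  shows "fourier_coeff (trig_sum A a) n = (if n \<in> A then a n else 0)"
proof -
  have "integral {-pi..pi} (\<lambda>x. trig_sum A a x * expi (- n) x)
      = integral {-pi..pi} (\<lambda>x. \<Sum>m\<in>A. a m * expi (m - n) x)"
    by (rule arg_cong [where f="integral _"])
       (auto simp: trig_sum_def sum_distrib_right mult.assoc expi_add)
  also have "\<dots> = (\<Sum>m\<in>A. a m * integral {-pi..pi} (expi (m - n)))"
    using assms by (subst integral_sum)
      (auto intro!: integrable_continuous_interval continuous_intros)
  also have "\<dots> = (\<Sum>m\<in>A. if n = m then 2 * of_real pi * a n else 0)"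
    by (intro sum.cong) (auto simp: integral_expi)
  also have "\<dots> = (if n \<in> A then 2 * of_real pi * a n else 0)" using assms by simp
  finally show ?thesis by (simp add: fourier_coeff_def)
qed

section \<open>Mean squares and best approximation\<close>

definition mean_sq :: "(real \<Rightarrow> complex) \<Rightarrow> real" where
  "mean_sq f = 1 / (2 * pi) * integral {-pi..pi} (\<lambda>x. (cmod (f x))\<^sup>2)"

lemma integral_mult_cnj_trig_sum:
  assumes "finite A" "continuous_on {-pi..pi} f"
  shows "1 / (2 * of_real pi) * integral {-pi..pi} (\<lambda>x. f x * cnj (trig_sum A a x))
         = (\<Sum>n\<in>A. cnj (a n) * fourier_coeff f n)"
proof -
  have "integral {-pi..pi} (\<lambda>x. f x * cnj (trig_sum A a x))
      = integral {-pi..pi} (\<lambda>x. \<Sum>n\<in>A. cnj (a n) * (f x * expi (- n) x))"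
    by (rule arg_cong [where f="integral _"])
       (auto simp: trig_sum_def cnj_expi sum_distrib_left algebra_simps)
  also have "\<dots> = (\<Sum>n\<in>A. cnj (a n) * integral {-pi..pi} (\<lambda>x. f x * expi (- n) x))"
    using assms by (subst integral_sum)
      (auto intro!: integrable_continuous_interval continuous_intros)
  finally show ?thesis
    by (simp add: fourier_coeff_def sum_divide_distrib)
qed

lemma of_real_mean_sq:
  assumes "continuous_on {-pi..pi} f"
  shows "of_real (mean_sq f) = 1 / (2 * of_real pi) * integral {-pi..pi} (\<lambda>x. f x * cnj (f x))"
proof -
  have "((\<lambda>x. (cmod (f x))\<^sup>2) has_integral integral {-pi..pi} (\<lambda>x. (cmod (f x))\<^sup>2)) {-pi..pi}"
    using assms by (intro integrable_integral integrable_continuous_interval continuous_intros)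
  then have "((\<lambda>x. complex_of_real ((cmod (f x))\<^sup>2)) has_integral
      of_real (integral {-pi..pi} (\<lambda>x. (cmod (f x))\<^sup>2))) {-pi..pi}"
    by (rule has_integral_of_real)
  then have "integral {-pi..pi} (\<lambda>x. f x * cnj (f x))
      = of_real (integral {-pi..pi} (\<lambda>x. (cmod (f x))\<^sup>2))"
    unfolding complex_norm_square by (rule integral_unique)
  then show ?thesis by (simp add: mean_sq_def)
qed

text \<open>Expand the square, then complete it coefficient by coefficient. The one identity serves
  twice: the choice a = c gives Bessel's inequality, and any other choice shows that the Fourier
  partial sum is the better approximation.\<close>

lemma mean_sq_diff_trig_sum:
  assumes "finite A" and f: "continuous_on {-pi..pi} f"
  shows "mean_sq (\<lambda>x. f x - trig_sum A a x)
    = mean_sq f - (\<Sum>n\<in>A. (cmod (fourier_coeff f n))\<^sup>2)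
      + (\<Sum>n\<in>A. (cmod (fourier_coeff f n - a n))\<^sup>2)"
proof -
  define p where "p = trig_sum A a"
  define J :: "(real \<Rightarrow> complex) \<Rightarrow> complex"
    where "J = (\<lambda>g. 1 / (2 * of_real pi) * integral {-pi..pi} g)"
  have p: "continuous_on {-pi..pi} p" unfolding p_def by (rule continuous_intros)
  have int: "(\<lambda>x. g x * cnj (h x)) integrable_on {-pi..pi}"
    if "continuous_on {-pi..pi} g" "continuous_on {-pi..pi} h" for g h :: "real \<Rightarrow> complex"
    using that by (intro integrable_continuous_interval continuous_intros)
  have fp: "J (\<lambda>x. f x * cnj (p x)) = (\<Sum>n\<in>A. cnj (a n) * fourier_coeff f n)"
    unfolding J_def p_def by (rule integral_mult_cnj_trig_sum) fact+
  have "J (\<lambda>x. p x * cnj (f x)) = cnj (J (\<lambda>x. f x * cnj (p x)))"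
    by (simp add: J_def integral_cnj algebra_simps)
  then have pf: "J (\<lambda>x. p x * cnj (f x)) = (\<Sum>n\<in>A. a n * cnj (fourier_coeff f n))"
    by (simp add: fp)
  have pp: "J (\<lambda>x. p x * cnj (p x)) = (\<Sum>n\<in>A. cnj (a n) * a n)"
    unfolding J_def p_def using assms p
    by (subst integral_mult_cnj_trig_sum) (auto simp: fourier_coeff_trig_sum p_def)
  have "of_real (mean_sq (\<lambda>x. f x - p x)) = J (\<lambda>x. (f x - p x) * cnj (f x - p x))"
    unfolding J_def by (intro of_real_mean_sq continuous_intros f p)
  also have "(\<lambda>x. (f x - p x) * cnj (f x - p x)) =
     (\<lambda>x. f x * cnj (f x) - f x * cnj (p x) - p x * cnj (f x) + p x * cnj (p x))"
    by (auto simp: algebra_simps)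
  also have "J \<dots> = J (\<lambda>x. f x * cnj (f x)) - J (\<lambda>x. f x * cnj (p x)) - J (\<lambda>x. p x * cnj (f x))
       + J (\<lambda>x. p x * cnj (p x))"
    unfolding J_def
    by (subst integral_add integral_diff;
        (intro integrable_add integrable_diff int f p)?)+ (simp add: algebra_simps)
  also have "J (\<lambda>x. f x * cnj (f x)) = of_real (mean_sq f)"
    unfolding J_def by (rule of_real_mean_sq [OF f, symmetric])
  also have "of_real (mean_sq f) - J (\<lambda>x. f x * cnj (p x)) - J (\<lambda>x. p x * cnj (f x))
       + J (\<lambda>x. p x * cnj (p x)) = of_real (mean_sq f
        - (\<Sum>n\<in>A. (cmod (fourier_coeff f n))\<^sup>2)
      + (\<Sum>n\<in>A. (cmod (fourier_coeff f n - a n))\<^sup>2))"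
    unfolding fp pf pp
    by (simp add: complex_norm_square sum.distrib sum_subtractf algebra_simps del: of_real_power)
  finally show ?thesis unfolding p_def of_real_eq_iff .
qed

section \<open>Density of trigonometric polynomials\<close>

definition trig_poly :: "(real \<Rightarrow> complex) \<Rightarrow> bool" where
  "trig_poly f \<longleftrightarrow> (\<exists>A a. finite A \<and> f = trig_sum A a)"

lemma trig_poly_monomial: "trig_poly (\<lambda>x. c * expi n x)"
  unfolding trig_poly_def by (rule exI [of _ "{n}"], rule exI [of _ "\<lambda>_. c"]) (auto simp: trig_sum_def)

lemma trig_poly_const: "trig_poly (\<lambda>x. c)"
  using trig_poly_monomial [of c 0] by simp

lemma trig_poly_add:
  assumes "trig_poly f" "trig_poly g"
  shows "trig_poly (\<lambda>x. f x + g x)"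
proof -
  obtain A a B b where A: "finite A" "f = trig_sum A a" and B: "finite B" "g = trig_sum B b"
    using assms unfolding trig_poly_def by metis
  have "trig_sum A a x = trig_sum (A \<union> B) (\<lambda>n. if n \<in> A then a n else 0) x" for x
    unfolding trig_sum_def using A B by (intro sum.mono_neutral_cong_left) auto
  moreover have "trig_sum B b x = trig_sum (A \<union> B) (\<lambda>n. if n \<in> B then b n else 0) x" for x
    unfolding trig_sum_def using A B by (intro sum.mono_neutral_cong_left) auto
  ultimately have "(\<lambda>x. f x + g x) = trig_sum (A \<union> B)
     (\<lambda>n. (if n \<in> A then a n else 0) + (if n \<in> B then b n else 0))"
    unfolding A B by (simp add: trig_sum_def sum.distrib [symmetric] algebra_simps fun_eq_iff)
  then show ?thesis unfolding trig_poly_def using A B by blast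
qed

lemma trig_poly_sum:
  "finite A \<Longrightarrow> (\<And>i. i \<in> A \<Longrightarrow> trig_poly (f i)) \<Longrightarrow> trig_poly (\<lambda>x. \<Sum>i\<in>A. f i x)"
  by (induction A rule: finite_induct) (auto intro: trig_poly_add trig_poly_const)

lemma trig_poly_mult:
  assumes "trig_poly f" "trig_poly g"
  shows "trig_poly (\<lambda>x. f x * g x)"
proof -
  obtain A a B b where A: "finite A" "f = trig_sum A a" and B: "finite B" "g = trig_sum B b"
    using assms unfolding trig_poly_def by metis
  have *: "(\<lambda>x. f x * g x) = (\<lambda>x. \<Sum>m\<in>A. \<Sum>n\<in>B. a m * b n * expi (m + n) x)"
    unfolding A B trig_sum_def sum_product expi_add [symmetric] by (simp add: algebra_simps)
  show ?thesis unfolding *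
    by (intro trig_poly_sum A B trig_poly_monomial)
qed

text \<open>Links Stone-Weierstrass on the circle to Fourier sums: on the circle a linear form is a
  combination of cosine and sine, and trigonometric polynomials are closed under sums and
  products.\<close>

lemma trig_poly_real_polynomial_function:
  assumes "real_polynomial_function g"
  shows "trig_poly (\<lambda>x. of_real (g (cis x)))"
  using assms
proof induction
  case (linear f)
  have cs: "of_real (cos x) = (expi 1 x + expi (-1) x) / 2"
    "of_real (sin x) = (expi 1 x - expi (-1) x) / (2 * \<i>)" for x
    by (auto simp: expi_cis complex_eq_iff)
  have "f (cis x) = cos x * f 1 + sin x * f \<i>" for x
  proof -
    have "cis x = cos x *\<^sub>R 1 + sin x *\<^sub>R \<i>" by (auto simp: complex_eq_iff)
    then show ?thesis using linear
      by (simp add: linear_simps bounded_linear.linear linear_add linear_scale)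
  qed
  then have "(\<lambda>x. complex_of_real (f (cis x))) =
     (\<lambda>x. (f 1 / 2 + f \<i> / (2 * \<i>)) * expi 1 x + (f 1 / 2 - f \<i> / (2 * \<i>)) * expi (-1) x)"
    by (auto simp add: cs field_simps)
  then show ?case by (simp only:) (intro trig_poly_add trig_poly_monomial)
qed (auto intro: trig_poly_add trig_poly_mult trig_poly_const)

lemma trig_poly_approx:
  fixes f :: "real \<Rightarrow> real"
  assumes f: "continuous_on UNIV f" and per: "\<And>x. f (x + 2 * pi) = f x" and e: "e > 0"
  obtains p where "trig_poly p" "\<And>x. x \<in> {-pi..pi} \<Longrightarrow> cmod (of_real (f x) - p x) < e"
proof -
  define F where "F = f \<circ> Arg"
  have cisF: "F (cis x) = f x" if "x \<in> {-pi..pi}" for x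
  proof (cases "x = -pi")
    case True
    moreover have "cis (-pi) = cis pi" by (simp add: complex_eq_iff)
    moreover have "Arg (cis pi) = pi" by (rule Arg_cis) simp
    ultimately show ?thesis using per [of "-pi"] by (simp add: F_def del: cis_pi)
  next
    case False
    then show ?thesis using that by (simp add: F_def Arg_cis)
  qed
  \<comment> \<open>\<open>Arg\<close> jumps across the negative real axis, so continuity of F
    cannot be composed from it. Instead closed preimages are exhibited as images under
    \<open>cis\<close> of compact subsets of [-pi, pi]; periodicity of f has already reconciled the
    two endpoints in \<open>cisF\<close>.\<close>
  have "closed (F -` B \<inter> sphere 0 1)" if B: "closed B" for B
  proof -
    have "F -` B \<inter> sphere 0 1 = cis ` ({-pi..pi} \<inter> f -` B)"
    proof (intro equalityI subsetI)
      fix z assume z: "z \<in> F -` B \<inter> sphere 0 1"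
      then have "z = cis (Arg z)" by (subst cis_Arg) (auto simp: sgn_eq)
      moreover have "Arg z \<in> {-pi..pi} \<inter> f -` B"
        using z Arg_bounded [of z] by (auto simp: F_def)
      ultimately show "z \<in> cis ` ({-pi..pi} \<inter> f -` B)" by blast
    qed (use cisF in auto)
    moreover have "compact ({-pi..pi} \<inter> f -` B)"
      using B f by (intro compact_Int_closed closed_vimage) (auto simp: continuous_on_eq_continuous_at)
    ultimately show ?thesis
      by (auto intro!: compact_imp_closed compact_continuous_image continuous_intros)
  qed
  then have "continuous_on (sphere 0 1) F"
    by (subst continuous_on_closed_vimage) auto
  then obtain g where g: "real_polynomial_function g"
     "\<And>z. z \<in> sphere (0::complex) 1 \<Longrightarrow> \<bar>F z - g z\<bar> < e"
    using Stone_Weierstrass_real_polynomial_function [of "sphere (0::complex) 1" F e] e by auto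
  show thesis
  proof
    show "trig_poly (\<lambda>x. of_real (g (cis x)))" by (rule trig_poly_real_polynomial_function) fact
    show "cmod (of_real (f x) - of_real (g (cis x))) < e" if "x \<in> {-pi..pi}" for x
      using g(2) [of "cis x"] cisF [OF that]
      by (metis mem_sphere_0 norm_cis norm_of_real of_real_diff)
  qed
qed

section \<open>Translates of periodic functions\<close>

lemma periodic_of_int:
  fixes f :: "real \<Rightarrow> 'a"
  assumes "\<And>x. f (x + p) = f x"
  shows "f (x + of_int k * p) = f x"
proof -
  interpret periodic_fun_simple f p by unfold_locales (rule assms)
  show ?thesis by (rule plus_of_int)
qed

lemma integral_shift:
  fixes f :: "real \<Rightarrow> 'a::euclidean_space"
  assumes "continuous_on UNIV f"
  shows "integral {a..b} (\<lambda>x. f (x + c)) = integral {a + c..b + c} f"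
proof -
  have "(f has_integral integral {a + c..b + c} f) (cbox (a + c) (b + c))"
    using assms by (auto intro!: integrable_integral integrable_continuous_interval
      continuous_on_subset [OF assms])
  from has_integral_affinity [OF this, of 1 c]
  show ?thesis by (simp add: integral_unique image_diff_atLeastAtMost add.commute)
qed

lemma integral_periodic_shift:
  fixes f :: "real \<Rightarrow> 'a::euclidean_space"
  assumes f: "continuous_on UNIV f" and per: "\<And>x. f (x + 2 * pi) = f x"
  shows "integral {-pi..pi} (\<lambda>x. f (x + a)) = integral {-pi..pi} f"
proof -
  \<comment> \<open>Whole periods are removed first; the remaining shift b lies within one period,
    and the piece that sticks out beyond pi is moved back by a single period.\<close>
  define k where "k = \<lfloor>a / (2 * pi)\<rfloor>"
  define b where "b = a - of_int k * (2 * pi)"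
  have "of_int k \<le> a / (2 * pi)" "a / (2 * pi) < of_int k + 1"
    unfolding k_def by linarith+
  then have b: "0 \<le> b" "b \<le> 2 * pi"
    by (auto simp: b_def field_simps)
  have int: "f integrable_on {c..d}" for c d
    by (intro integrable_continuous_interval continuous_on_subset [OF f]) auto
  have "f (x + a) = f (x + b)" for x
    using periodic_of_int [of f "2 * pi" "x + b" k] per by (simp add: b_def)
  then have "integral {-pi..pi} (\<lambda>x. f (x + a)) = integral {-pi + b..pi + b} f"
    using integral_shift [OF f] by simp
  also have "\<dots> = integral {-pi + b..pi} f + integral {pi..pi + b} f"
    using b int by (intro Henstock_Kurzweil_Integration.integral_combine [symmetric]) auto
  also have "integral {pi..pi + b} f = integral {-pi..-pi + b} (\<lambda>x. f (x + 2 * pi))"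
    by (subst integral_shift [OF f]) (simp add: algebra_simps)
  also have "\<dots> = integral {-pi..-pi + b} f" by (simp add: per)
  also have "integral {-pi + b..pi} f + integral {-pi..-pi + b} f = integral {-pi..pi} f"
    using b int Henstock_Kurzweil_Integration.integral_combine [of "-pi" "-pi + b" pi f]
    by (simp add: add.commute)
  finally show ?thesis .
qed

lemma fourier_coeff_shift:
  assumes f: "continuous_on UNIV f" and per: "\<And>x. f (x + 2 * pi) = f x"
  shows "fourier_coeff (\<lambda>x. f (x + a)) n = expi n a * fourier_coeff f n"
proof -
  have "integral {-pi..pi} (\<lambda>x. f x * expi (- n) x)
      = integral {-pi..pi} (\<lambda>x. f (x + a) * expi (- n) (x + a))"
    by (rule integral_periodic_shift [symmetric])
       (auto intro!: continuous_intros f simp: per expi_periodic)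
  also have "\<dots> = expi (- n) a * integral {-pi..pi} (\<lambda>x. f (x + a) * expi (- n) x)"
    by (simp add: expi_shift algebra_simps flip: integral_mult_right)
  finally show ?thesis
    using expi_add [of n a "-n"] by (simp add: fourier_coeff_def mult.assoc [symmetric])
qed

lemma fourier_coeff_add:
  assumes "continuous_on {-pi..pi} f" "continuous_on {-pi..pi} g"
  shows "fourier_coeff (\<lambda>x. f x + g x) n = fourier_coeff f n + fourier_coeff g n"
proof -
  have "integral {-pi..pi} (\<lambda>x. (f x + g x) * expi (- n) x)
     = integral {-pi..pi} (\<lambda>x. f x * expi (- n) x) + integral {-pi..pi} (\<lambda>x. g x * expi (- n) x)"
    unfolding distrib_right by (intro integral_add integrable_expi_mult assms)
  then show ?thesis by (simp add: fourier_coeff_def algebra_simps)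
qed

lemma mean_sq_nonneg:
  assumes "continuous_on {-pi..pi} f"
  shows "mean_sq f \<ge> 0"
  unfolding mean_sq_def
  by (intro mult_nonneg_nonneg integral_nonneg integrable_continuous_interval continuous_intros
       assms) auto

lemma mean_sq_le:
  assumes f: "continuous_on {-pi..pi} f" and e: "\<And>x. x \<in> {-pi..pi} \<Longrightarrow> cmod (f x) \<le> e"
  shows "mean_sq f \<le> e\<^sup>2"
proof -
  have "integral {-pi..pi} (\<lambda>x. (cmod (f x))\<^sup>2) \<le> integral {-pi..pi} (\<lambda>x. e\<^sup>2)"
    by (intro integral_le integrable_continuous_interval continuous_intros f power_mono e) auto
  then show ?thesis by (simp add: mean_sq_def field_simps)
qed

lemma parseval:
  fixes f :: "real \<Rightarrow> real"
  assumes f: "continuous_on UNIV f" and per: "\<And>x. f (x + 2 * pi) = f x"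
  shows "((\<lambda>n. (cmod (fourier_coeff (\<lambda>x. of_real (f x)) n))\<^sup>2)
           has_sum mean_sq (\<lambda>x. of_real (f x))) UNIV"
proof -
  define F :: "real \<Rightarrow> complex" where "F = (\<lambda>x. of_real (f x))"
  define c where "c = fourier_coeff F"
  have F: "continuous_on {-pi..pi} F"
    unfolding F_def by (intro continuous_intros continuous_on_subset [OF f]) auto
  \<comment> \<open>Both bounds come from \<open>mean_sq_diff_trig_sum\<close>: a = c shows that
    partial sums never exceed \<open>mean_sq F\<close>, and dropping the approximation error bounds
    the gap. The bound depends on B only, so it holds for every larger A, as convergence along
    finite sets demands.\<close>
  have dist: "\<bar>(\<Sum>n\<in>A. (cmod (c n))\<^sup>2) - mean_sq F\<bar> \<le> mean_sq (\<lambda>x. F x - trig_sum B b x)"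
    if "finite A" "B \<subseteq> A" for A B b
  proof -
    define a where "a = (\<lambda>n. if n \<in> B then b n else 0)"
    have "trig_sum B b = trig_sum A a"
      unfolding trig_sum_def a_def using that
      by (intro ext sum.mono_neutral_cong_left) auto
    then have "mean_sq (\<lambda>x. F x - trig_sum B b x)
         = mean_sq F - (\<Sum>n\<in>A. (cmod (c n))\<^sup>2) + (\<Sum>n\<in>A. (cmod (c n - a n))\<^sup>2)"
      using mean_sq_diff_trig_sum [OF that(1) F, of a] by (simp add: c_def)
    moreover have "(\<Sum>n\<in>A. (cmod (c n - a n))\<^sup>2) \<ge> 0" by (intro sum_nonneg) auto
    moreover have "0 \<le> mean_sq F - (\<Sum>n\<in>A. (cmod (c n))\<^sup>2)"
      using mean_sq_diff_trig_sum [OF that(1) F, of c]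
        mean_sq_nonneg [of "\<lambda>x. F x - trig_sum A c x"] F
      by (simp add: c_def continuous_intros)
    ultimately show ?thesis by linarith
  qed
  have "((\<lambda>A. \<Sum>n\<in>A. (cmod (c n))\<^sup>2) \<longlongrightarrow> mean_sq F) (finite_subsets_at_top UNIV)"
  proof (rule tendstoI)
    fix e :: real assume e: "e > 0"
    \<comment> \<open>\<open>mean_sq_le\<close> squares the uniform error, which leaves
      \<open>e / 2\<close>, strictly below e.\<close>
    obtain p where p: "trig_poly p" "\<And>x. x \<in> {-pi..pi} \<Longrightarrow> cmod (of_real (f x) - p x) < sqrt (e / 2)"
      using trig_poly_approx [OF f per, of "sqrt (e / 2)"] e by auto
    then obtain B b where B: "finite B" "p = trig_sum B b"
      unfolding trig_poly_def by blast
    have "mean_sq (\<lambda>x. F x - p x) \<le> (sqrt (e / 2))\<^sup>2"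
      using p(2) F by (intro mean_sq_le)
        (auto simp: F_def B intro!: continuous_intros less_imp_le)
    then have "mean_sq (\<lambda>x. F x - p x) < e" using e by simp
    then show "\<forall>\<^sub>F A in finite_subsets_at_top UNIV. dist (\<Sum>n\<in>A. (cmod (c n))\<^sup>2) (mean_sq F) < e"
      unfolding eventually_finite_subsets_at_top dist_real_def B(2)
      using B(1) dist [of _ B b] by (intro exI [of _ B]) (auto intro: le_less_trans)
  qed
  then show ?thesis by (simp add: has_sum_def c_def F_def)
qed

lemma mean_sq_of_real:
  "mean_sq (\<lambda>x. of_real (f x)) = 1 / (2 * pi) * integral {-pi..pi} (\<lambda>x. (f x)\<^sup>2)"
  by (simp add: mean_sq_def)

text \<open>Adding to a function its translate by t multiplies the n-th coefficient by
  \<open>1 + expi n t\<close>. This serves the polarization below and, with t = pi - \<theta>, the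
  excluded body.\<close>

lemma norm_one_plus_expi: "(cmod (1 + expi n t))\<^sup>2 = 2 + 2 * cos (of_int n * t)"
proof -
  have "(cmod (1 + expi n t))\<^sup>2 = (1 + cos (of_int n * t))\<^sup>2 + (sin (of_int n * t))\<^sup>2"
    by (simp add: expi_cis cmod_power2)
  also have "\<dots> = 2 + 2 * cos (of_int n * t)"
    using sin_cos_squared_add [of "of_int n * t"] unfolding power2_sum by simp
  finally show ?thesis .
qed

text \<open>Polarization: Parseval's identity for \<open>f x + f (x + t)\<close>.\<close>

lemma parseval_autocorrelation:
  fixes f :: "real \<Rightarrow> real"
  assumes f: "continuous_on UNIV f" and per: "\<And>x. f (x + 2 * pi) = f x"
  shows "((\<lambda>n. (cmod (fourier_coeff (\<lambda>x. of_real (f x)) n))\<^sup>2 * cos (of_int n * t))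
           has_sum 1 / (2 * pi) * integral {-pi..pi} (\<lambda>x. f x * f (x + t))) UNIV"
proof -
  define F :: "real \<Rightarrow> complex" where "F = (\<lambda>x. of_real (f x))"
  define c where "c = fourier_coeff F"
  define g where "g = (\<lambda>x. f x + f (x + t))"
  have ft: "continuous_on S (\<lambda>x. f (x + t))" for S
    by (rule continuous_on_compose2 [OF f]) (auto intro!: continuous_intros)
  have f': "continuous_on S f" for S
    by (rule continuous_on_subset [OF f]) auto
  have F: "continuous_on S F" "continuous_on S (\<lambda>x. F (x + t))" for S
    unfolding F_def by (intro continuous_intros f' ft)+
  have perg: "g (x + 2 * pi) = g x" for x
    using per [of x] per [of "x + t"] by (simp add: g_def algebra_simps)
  have "fourier_coeff (\<lambda>x. F x + F (x + t)) n = c n * (1 + expi n t)" for n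
    using fourier_coeff_shift [of F t n] F per
    by (simp add: fourier_coeff_add c_def F_def algebra_simps)
  moreover note norm_one_plus_expi
  ultimately have gc: "(cmod (fourier_coeff (\<lambda>x. of_real (g x)) n))\<^sup>2
      = (cmod (c n))\<^sup>2 * (2 + 2 * cos (of_int n * t))" for n
    unfolding g_def F_def of_real_add by (simp only: norm_mult power_mult_distrib)
  have contg: "continuous_on UNIV g" unfolding g_def by (intro continuous_intros f ft)
  have "((\<lambda>n. (cmod (c n))\<^sup>2 * (2 + 2 * cos (of_int n * t))) has_sum mean_sq (\<lambda>x. of_real (g x))) UNIV"
    using parseval [OF contg perg] by (simp only: gc)
  moreover have "((\<lambda>n. - 2 * (cmod (c n))\<^sup>2) has_sum - 2 * mean_sq F) UNIV"
    unfolding c_def F_def by (intro has_sum_cmult_right parseval f per)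
  ultimately have "((\<lambda>n. 1 / 2 * ((cmod (c n))\<^sup>2 * (2 + 2 * cos (of_int n * t)) + - 2 * (cmod (c n))\<^sup>2))
       has_sum 1 / 2 * (mean_sq (\<lambda>x. of_real (g x)) + - 2 * mean_sq F)) UNIV"
    by (rule has_sum_cmult_right [OF has_sum_add])
  moreover have "1 / 2 * (mean_sq (\<lambda>x. of_real (g x)) + - 2 * mean_sq F)
     = 1 / (2 * pi) * integral {-pi..pi} (\<lambda>x. f x * f (x + t))"
  proof -
    have int: "h integrable_on {-pi..pi}" if "continuous_on UNIV h" for h :: "real \<Rightarrow> real"
      by (intro integrable_continuous_interval continuous_on_subset [OF that]) auto
    have "integral {-pi..pi} (\<lambda>x. (g x)\<^sup>2)
       = integral {-pi..pi} (\<lambda>x. (f x)\<^sup>2 + (f (x + t))\<^sup>2 + 2 * (f x * f (x + t)))"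
      by (simp add: g_def power2_sum mult.assoc)
    also have "\<dots> = integral {-pi..pi} (\<lambda>x. (f x)\<^sup>2) + integral {-pi..pi} (\<lambda>x. (f (x + t))\<^sup>2)
         + 2 * integral {-pi..pi} (\<lambda>x. f x * f (x + t))"
      by (intro integral_unique has_integral_add has_integral_mult_right integrable_integral int
          continuous_intros f ft)
    also have "integral {-pi..pi} (\<lambda>x. (f (x + t))\<^sup>2) = integral {-pi..pi} (\<lambda>x. (f x)\<^sup>2)"
      by (rule integral_periodic_shift [of "\<lambda>x. (f x)\<^sup>2"]) (auto intro!: continuous_intros f simp: per)
    finally show ?thesis unfolding F_def mean_sq_of_real by (simp add: field_simps)
  qed
  ultimately show ?thesis by (simp add: c_def F_def distrib_left mult.commute [of pi])
qed

section \<open>Circumscribed polygons with equally spaced normals\<close>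

lemma inner_vec2: "(x::real^2) \<bullet> y = x $ 1 * y $ 1 + x $ 2 * y $ 2"
  by (simp add: inner_vec_def sum_2)

lemma unit_dir_nth [simp]: "unit_dir \<phi> $ 1 = cos \<phi>" "unit_dir \<phi> $ 2 = sin \<phi>"
  by (simp_all add: unit_dir_def)

lemma inner_unit_dir: "unit_dir \<phi> \<bullet> unit_dir \<psi> = cos (\<phi> - \<psi>)"
  by (simp add: inner_vec2 cos_diff)

lemma norm_unit_dir [simp]: "norm (unit_dir \<phi>) = 1"
  by (simp add: norm_eq_sqrt_inner inner_unit_dir)

lemma unit_dir_2pi [simp]: "unit_dir (\<phi> + 2 * pi) = unit_dir \<phi>"
  by (simp add: vec_eq_iff forall_2)

lemma unit_dir_pi: "unit_dir (\<phi> + pi) = - unit_dir \<phi>"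
  by (simp add: vec_eq_iff forall_2)

text \<open>Resolves a direction along two directions on either side of it. For \<alpha>, \<beta>
  and \<alpha> + \<beta> in [0, pi] all coefficients are nonnegative, so sublinearity can be applied
  to it.\<close>

lemma unit_dir_subconvex:
  "sin (\<alpha> + \<beta>) *\<^sub>R unit_dir \<phi> = sin \<beta> *\<^sub>R unit_dir (\<phi> - \<alpha>) + sin \<alpha> *\<^sub>R unit_dir (\<phi> + \<beta>)"
  by (simp add: vec_eq_iff forall_2 sin_add cos_add sin_diff cos_diff algebra_simps)

lemma unit_dir_rotate:
  "unit_dir (\<psi> + t) = cos t *\<^sub>R unit_dir \<psi> + sin t *\<^sub>R unit_dir (\<psi> + pi / 2)"
  by (simp add: vec_eq_iff forall_2 sin_add cos_add)

lemma unit_dir_frame: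
  "x = (unit_dir \<psi> \<bullet> x) *\<^sub>R unit_dir \<psi> + (unit_dir (\<psi> + pi / 2) \<bullet> x) *\<^sub>R unit_dir (\<psi> + pi / 2)"
proof -
  have *: "cos \<psi> * (cos \<psi> * y) + sin \<psi> * (sin \<psi> * y) = y" for y
    using sin_cos_squared_add [of \<psi>]
    by (simp add: power2_eq_square flip: mult.assoc distrib_right)
  show ?thesis
    by (simp add: vec_eq_iff forall_2 inner_vec2 sin_add cos_add algebra_simps *)
qed

lemma exists_unit_dir:
  obtains \<phi> where "x = norm x *\<^sub>R unit_dir \<phi>"
proof (cases "x = 0")
  case False
  define y where "y = x /\<^sub>R norm x"
  have "norm y = 1" using False by (simp add: y_def)
  then have "(y $ 1)\<^sup>2 + (y $ 2)\<^sup>2 = 1"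
    by (simp add: norm_eq_sqrt_inner inner_vec2 power2_eq_square)
  then obtain \<phi> where "y $ 1 = cos \<phi>" "y $ 2 = sin \<phi>"
    using sincos_total_2pi by metis
  then have "y = unit_dir \<phi>" by (simp add: vec_eq_iff forall_2)
  then have "x = norm x *\<^sub>R unit_dir \<phi>" using False by (simp add: y_def flip: \<open>y = unit_dir \<phi>\<close>)
  then show thesis by (rule that)
qed (use that [of 0] in simp)

text \<open>Chord against arc: the chord has length \<open>2 * \<bar>sin y\<bar>\<close>, where y is
  half the angle.\<close>

lemma dist_unit_dir_le: "norm (unit_dir \<phi> - unit_dir \<psi>) \<le> \<bar>\<phi> - \<psi>\<bar>"
proof -
  define y where "y = (\<phi> - \<psi>) / 2"
  have y: "\<phi> - \<psi> = 2 * y" by (simp add: y_def)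
  have "(norm (unit_dir \<phi> - unit_dir \<psi>))\<^sup>2 = 2 - 2 * cos (\<phi> - \<psi>)"
    by (simp add: power2_norm_eq_inner inner_diff_left inner_diff_right inner_unit_dir
        cos_diff [of \<psi> \<phi>] cos_diff [of \<phi> \<psi>])
  also have "\<dots> = (2 * sin y)\<^sup>2"
    unfolding y cos_double_sin by (simp add: power_mult_distrib)
  also have "\<dots> \<le> (\<phi> - \<psi>)\<^sup>2"
    using abs_sin_x_le_abs_x [of y] unfolding y
    by (simp add: abs_le_square_iff [symmetric] abs_mult)
  finally show ?thesis by (simp add: abs_le_square_iff [symmetric])
qed

text \<open>Equal normals have inner product 1, so their angles differ by a multiple of
  \<open>2 * pi\<close> and their indices by a multiple of \<open>2 * m\<close>, too large for
  distinct indices within one turn.\<close>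

lemma unit_dir_eq_imp:
  assumes "unit_dir (\<phi> + of_int j * (pi / m)) = unit_dir (\<phi> + of_int k * (pi / m))"
    "j \<in> {0..<2 * int m}" "k \<in> {0..<2 * int m}"
  shows "j = k"
proof -
  have m: "m > 0" using assms by auto
  have "cos (of_int (j - k) * (pi / m)) = 1"
    using inner_unit_dir [of "\<phi> + of_int j * (pi / m)" "\<phi> + of_int k * (pi / m)"]
      inner_unit_dir [of "\<phi> + of_int j * (pi / m)" "\<phi> + of_int j * (pi / m)"] assms(1)
    by (simp add: algebra_simps)
  then obtain n :: int where "of_int (j - k) * (pi / m) = of_int n * (2 * pi)"
    unfolding cos_one_2pi_int by auto
  then have "pi * real_of_int (j - k) = pi * real_of_int (n * (2 * int m))"
    using m by (simp add: field_simps)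
  then have "real_of_int (j - k) = real_of_int (n * (2 * int m))"
    unfolding mult_cancel_left by simp
  then have eq: "j - k = n * (2 * int m)" by linarith
  have "\<bar>j - k\<bar> < 2 * int m" using assms by auto
  then have "n = 0"
    unfolding eq abs_mult using m by (cases "n = 0") (auto simp: mult_less_cancel_right2)
  then show ?thesis using eq by simp
qed

section \<open>Circumscribed polygons and their vertices\<close>

text \<open>Support number times the length of the edge with normal \<psi>, that is, twice the area
  of the triangle over this edge; for small t it approximates t h (h + h'').\<close>

definition edge_term :: "(real \<Rightarrow> real) \<Rightarrow> real \<Rightarrow> real \<Rightarrow> real" where
  "edge_term g t \<psi> = g \<psi> * (g (\<psi> + t) + g (\<psi> - t) - 2 * cos t * g \<psi>) / sin t"

definition edge_sum :: "(real \<Rightarrow> real) \<Rightarrow> nat \<Rightarrow> real \<Rightarrow> real" where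
  "edge_sum g m \<phi> = (\<Sum>k\<in>{0..<2 * int m}. edge_term g (pi / m) (\<phi> + of_int k * (pi / m))) / 2"

text \<open>The index runs over all integers, although for periodic g the constraints repeat, so
  that every k has neighbours k - 1 and k + 1 without wrap-around.\<close>

definition polygon :: "(real \<Rightarrow> real) \<Rightarrow> nat \<Rightarrow> real \<Rightarrow> (real^2) set" where
  "polygon g m \<phi> = {x. \<forall>k::int. unit_dir (\<phi> + of_int k * (pi / m)) \<bullet> x \<le> g (\<phi> + of_int k * (pi / m))}"

text \<open>The second condition is sublinearity of the support function, written in terms of its
  restriction to unit vectors.\<close>

locale circumscribing =
  fixes g :: "real \<Rightarrow> real"
  assumes periodic: "g (x + 2 * pi) = g x"
    and subconvex: "\<lbrakk>0 \<le> \<alpha>; 0 \<le> \<beta>; \<alpha> + \<beta> \<le> pi\<rbrakk> \<Longrightarrow>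
          sin (\<alpha> + \<beta>) * g \<phi> \<le> sin \<beta> * g (\<phi> - \<alpha>) + sin \<alpha> * g (\<phi> + \<beta>)"
begin

lemma periodic_index:
  fixes m :: nat
  assumes "m > 0"
  shows "g (\<psi> + of_int i * (pi / m)) = g (\<psi> + of_int (i mod (2 * int m)) * (pi / m))"
    and "unit_dir (\<psi> + of_int i * (pi / m)) = unit_dir (\<psi> + of_int (i mod (2 * int m)) * (pi / m))"
proof -
  define r q where "r = i mod (2 * int m)" and "q = i div (2 * int m)"
  have "i = q * (2 * int m) + r"
    using div_mult_mod_eq [of i "2 * int m"] by (simp only: r_def q_def)
  then have "\<psi> + of_int i * (pi / m) = (\<psi> + of_int r * (pi / m)) + of_int q * (2 * pi)"
    using assms by (simp add: field_simps)
  then show "g (\<psi> + of_int i * (pi / m)) = g (\<psi> + of_int (i mod (2 * int m)) * (pi / m))"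
    and "unit_dir (\<psi> + of_int i * (pi / m)) = unit_dir (\<psi> + of_int (i mod (2 * int m)) * (pi / m))"
    using periodic_of_int [of g "2 * pi", OF periodic] periodic_of_int [of unit_dir "2 * pi", OF unit_dir_2pi]
    unfolding r_def by (simp_all only:)
qed

text \<open>One of \<psi> and \<psi> + t lies between the other and the third direction. At it g
  obeys the subconvexity inequality, while the linear functional of w obeys the same relation with
  equality; as both agree at \<psi> and \<psi> + t, w cannot exceed g in the third direction. Hence
  consecutive support lines meet in a point of the polygon.\<close>

lemma tangent_below:
  fixes m :: nat and i :: int
  assumes m: "m \<ge> 2" and t: "t = pi / m"
    and w: "unit_dir \<psi> \<bullet> w = g \<psi>" "unit_dir (\<psi> + t) \<bullet> w = g (\<psi> + t)"
  shows "unit_dir (\<psi> + of_int i * t) \<bullet> w \<le> g (\<psi> + of_int i * t)"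
proof -
  define r where "r = i mod (2 * int m)"
  have r: "0 \<le> r" "r < 2 * int m" using m by (auto simp: r_def)
  have t0: "0 < t" "t < pi" using m by (auto simp: t field_simps)
  then have st: "sin t > 0" by (rule sin_gt_zero)
  have mt: "real m * t = pi" using m by (simp add: t)
  have le: "of_int j * t \<le> pi" if "j \<le> int m" for j
    using mult_right_mono [of "of_int j" "real m" t] that t0 mt by linarith
  have id: "sin (\<alpha> + \<beta>) * (unit_dir \<phi> \<bullet> w)
     = sin \<beta> * (unit_dir (\<phi> - \<alpha>) \<bullet> w) + sin \<alpha> * (unit_dir (\<phi> + \<beta>) \<bullet> w)" for \<phi> \<alpha> \<beta>
    using arg_cong [OF unit_dir_subconvex [of \<alpha> \<beta> \<phi>], of "\<lambda>x. x \<bullet> w"]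
    by (simp add: inner_add_left)
  have "unit_dir (\<psi> + of_int r * t) \<bullet> w \<le> g (\<psi> + of_int r * t)"
  proof -
    consider "r = 0" | "1 \<le> r" "r \<le> int m" | "int m < r" using r by linarith
    then show ?thesis
    proof cases
      case 1
      then show ?thesis using w by simp
    next
      case 2
      have "0 \<le> of_int r * t - t" using 2 t0 by (simp add: algebra_simps)
      then have "sin (t + (of_int r * t - t)) * g (\<psi> + t) \<le>
        sin (of_int r * t - t) * g (\<psi> + t - t) + sin t * g (\<psi> + t + (of_int r * t - t))"
        using t0 le [of r] 2 by (intro subconvex) auto
      then have "sin t * (unit_dir (\<psi> + of_int r * t) \<bullet> w) \<le> sin t * g (\<psi> + of_int r * t)"
        using id [of t "of_int r * t - t" "\<psi> + t"] w by simp
      then show ?thesis using st by simp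
    next
      case 3
      \<comment> \<open>Counted backwards: r steps forward equal s steps back up to a full turn, and
        r > m gives s + 1 \<le> m, so that \<psi> lies within a half turn between \<psi> - s t and
        \<psi> + t.\<close>
      define s where "s = 2 * int m - r"
      have s: "1 \<le> s" "s + 1 \<le> int m" using 3 r by (auto simp: s_def)
      have "of_int s * t + t \<le> pi" using le [OF s(2)] by (simp add: algebra_simps)
      then have "sin (of_int s * t + t) * g \<psi> \<le>
        sin t * g (\<psi> - of_int s * t) + sin (of_int s * t) * g (\<psi> + t)"
        using t0 s by (intro subconvex) auto
      then have "sin t * (unit_dir (\<psi> - of_int s * t) \<bullet> w) \<le> sin t * g (\<psi> - of_int s * t)"
        using id [of "of_int s * t" t \<psi>] w by simp
      moreover have "\<psi> + of_int r * t = (\<psi> - of_int s * t) + 2 * pi"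
        using mt by (simp add: s_def algebra_simps)
      ultimately show ?thesis using st periodic by (simp only: unit_dir_2pi mult_le_cancel_left_pos)
    qed
  qed
  then show ?thesis
    using periodic_index [of m \<psi> i] m unfolding r_def t by simp
qed

text \<open>Meeting point of the support lines with normals \<psi> and \<psi> + t, solved in the
  orthonormal frame at \<psi>.\<close>

definition vertex :: "real \<Rightarrow> real \<Rightarrow> real^2" where
  "vertex t \<psi> = g \<psi> *\<^sub>R unit_dir \<psi> + ((g (\<psi> + t) - cos t * g \<psi>) / sin t) *\<^sub>R unit_dir (\<psi> + pi / 2)"

lemma inner_vertex:
  assumes "sin t \<noteq> 0"
  shows "unit_dir \<psi> \<bullet> vertex t \<psi> = g \<psi>" "unit_dir (\<psi> + t) \<bullet> vertex t \<psi> = g (\<psi> + t)"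
  using assms by (simp_all add: vertex_def inner_add_right inner_unit_dir cos_diff cos_add sin_add)

text \<open>Puts the second endpoint of the edge with normal \<psi> into the same frame. Both
  endpoints then have height \<open>g \<psi>\<close>, and the edge length is the difference of their
  tangential coordinates.\<close>

lemma vertex_prev:
  assumes "sin t \<noteq> 0"
  shows "vertex t (\<psi> - t) =
    g \<psi> *\<^sub>R unit_dir \<psi> - ((g (\<psi> - t) - cos t * g \<psi>) / sin t) *\<^sub>R unit_dir (\<psi> + pi / 2)"
proof -
  define w where "w = vertex t (\<psi> - t)"
  have 1: "unit_dir \<psi> \<bullet> w = g \<psi>"
    using inner_vertex(2) [OF assms, of "\<psi> - t"] by (simp add: w_def)
  have "unit_dir (\<psi> - t) \<bullet> w = g (\<psi> - t)"
    using inner_vertex(1) [OF assms, of "\<psi> - t"] by (simp add: w_def)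
  then have "cos t * g \<psi> - sin t * (unit_dir (\<psi> + pi / 2) \<bullet> w) = g (\<psi> - t)"
    using unit_dir_rotate [of \<psi> "-t"] 1 by (simp add: inner_diff_left)
  then have "unit_dir (\<psi> + pi / 2) \<bullet> w = - ((g (\<psi> - t) - cos t * g \<psi>) / sin t)"
    using assms by (simp add: field_simps)
  then show ?thesis
    using unit_dir_frame [of w \<psi>] 1 unfolding w_def by simp
qed

section \<open>Dissection into triangles with apex at the origin\<close>

definition sector :: "real \<Rightarrow> real \<Rightarrow> (real^2) set" where
  "sector t \<psi> = convex hull {0, vertex t (\<psi> - t), vertex t \<psi>}"

lemma content_sector:
  assumes "0 < t" "t \<le> pi / 2" "g \<psi> \<ge> 0"
  shows "measure lebesgue (sector t \<psi>) = edge_term g t \<psi> / 2"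
proof -
  have st: "sin t > 0" using assms by (intro sin_gt_zero) auto
  have "sin (t + t) * g \<psi> \<le> sin t * g (\<psi> - t) + sin t * g (\<psi> + t)"
    using assms by (intro subconvex) auto
  then have "sin t * (2 * cos t * g \<psi>) \<le> sin t * (g (\<psi> + t) + g (\<psi> - t))"
    unfolding sin_add by (simp only: algebra_simps)
  then have nn: "g (\<psi> + t) + g (\<psi> - t) - 2 * cos t * g \<psi> \<ge> 0"
    using st by simp
  define a b where "a = (g (\<psi> + t) - cos t * g \<psi>) / sin t"
    and "b = (g (\<psi> - t) - cos t * g \<psi>) / sin t"
  have ab: "g \<psi> * (a + b) = edge_term g t \<psi>"
    using st by (simp add: a_def b_def edge_term_def field_simps)
  have v: "vertex t \<psi> = g \<psi> *\<^sub>R unit_dir \<psi> + a *\<^sub>R unit_dir (\<psi> + pi / 2)"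
    "vertex t (\<psi> - t) = g \<psi> *\<^sub>R unit_dir \<psi> - b *\<^sub>R unit_dir (\<psi> + pi / 2)"
    using st vertex_prev [of t \<psi>] by (simp_all add: vertex_def [of _ \<psi>] a_def b_def)
  have cross: "(x *\<^sub>R unit_dir \<psi> + a *\<^sub>R unit_dir (\<psi> + pi / 2)) $ 1 *
      (x *\<^sub>R unit_dir \<psi> - b *\<^sub>R unit_dir (\<psi> + pi / 2)) $ 2 -
      (x *\<^sub>R unit_dir \<psi> - b *\<^sub>R unit_dir (\<psi> + pi / 2)) $ 1 *
      (x *\<^sub>R unit_dir \<psi> + a *\<^sub>R unit_dir (\<psi> + pi / 2)) $ 2 = - (x * (a + b))" for x
  proof -
    have "(x * c - a * d) * (x * d - b * c) - (x * c + b * d) * (x * d + a * c)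
       = - (x * (a + b)) * (d * d + c * c)" for c d :: real
      by (simp add: algebra_simps)
    note this [of "cos \<psi>" "sin \<psi>"]
    also have "sin \<psi> * sin \<psi> + cos \<psi> * cos \<psi> = 1"
      using sin_cos_squared_add [of \<psi>] by (simp add: power2_eq_square)
    finally show ?thesis by (simp add: sin_add cos_add)
  qed
  have "compact (sector t \<psi>)"
    unfolding sector_def by (intro finite_imp_compact_convex_hull) auto
  then have "measure lebesgue (sector t \<psi>) = measure lborel (sector t \<psi>)"
    by (intro measure_completion) (auto dest: compact_imp_closed)
  also have "\<dots> = \<bar>edge_term g t \<psi>\<bar> / 2"
    unfolding sector_def content_triangle using cross [of "g \<psi>"] unfolding v ab by simp
  also have "edge_term g t \<psi> \<ge> 0"
    unfolding edge_term_def using nn st assms by auto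
  then have "\<bar>edge_term g t \<psi>\<bar> = edge_term g t \<psi>" by simp
  finally show ?thesis .
qed

text \<open>On the triangle over edge k the ratio of \<open>unit_dir _ \<bullet> x\<close> to
  \<open>g _\<close> is largest in direction k. Each claim is a linear inequality in x, so the three
  corners decide. Applied with both orders of the indices, the second claim also controls
  overlaps.\<close>

lemma sector_normalized:
  fixes m :: nat and k j :: int
  assumes m: "m \<ge> 2" and t: "t = pi / m" and pos: "\<And>\<psi>. g \<psi> > 0"
    and x: "x \<in> sector t (\<phi> + of_int k * t)"
  shows "unit_dir (\<phi> + of_int k * t) \<bullet> x \<le> g (\<phi> + of_int k * t)"
    and "(unit_dir (\<phi> + of_int j * t) \<bullet> x) * g (\<phi> + of_int k * t)
      \<le> (unit_dir (\<phi> + of_int k * t) \<bullet> x) * g (\<phi> + of_int j * t)"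
    and "0 \<le> unit_dir (\<phi> + of_int k * t) \<bullet> x"
proof -
  have t0: "0 < t" "t < pi" using m by (auto simp: t field_simps)
  then have st: "sin t \<noteq> 0" using sin_gt_zero [of t] by simp
  let ?u = "\<lambda>k::int. unit_dir (\<phi> + of_int k * t)" and ?g = "\<lambda>k::int. g (\<phi> + of_int k * t)"
  define H where "H = {x. 0 \<le> ?u k \<bullet> x} \<inter> {x. ?u k \<bullet> x \<le> ?g k}
      \<inter> {x. (?g k *\<^sub>R ?u j - ?g j *\<^sub>R ?u k) \<bullet> x \<le> 0}"
  have "convex {x. 0 \<le> ?u k \<bullet> x}"
    using convex_halfspace_ge [of 0 "?u k"] by simp
  then have "convex H" unfolding H_def
    by (intro convex_Int convex_halfspace_le)
  have below: "?u j \<bullet> vertex t (\<phi> + of_int k * t) \<le> ?g j"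
    using tangent_below [OF m t inner_vertex [OF st], of "\<phi> + of_int k * t" "j - k"]
    by (simp add: algebra_simps)
  \<comment> \<open>This vertex is based one index earlier, hence \<open>j - k + 1\<close> steps to
    direction j.\<close>
  have below': "?u j \<bullet> vertex t (\<phi> + of_int k * t - t) \<le> ?g j"
    using tangent_below [OF m t inner_vertex [OF st], of "\<phi> + of_int k * t - t" "j - k + 1"]
    by (simp add: algebra_simps)
  have at: "?u k \<bullet> vertex t (\<phi> + of_int k * t) = ?g k"
     "?u k \<bullet> vertex t (\<phi> + of_int k * t - t) = ?g k"
    using inner_vertex [OF st, of "\<phi> + of_int k * t"] inner_vertex [OF st, of "\<phi> + of_int k * t - t"]
    by simp_all
  have "{0, vertex t (\<phi> + of_int k * t - t), vertex t (\<phi> + of_int k * t)} \<subseteq> H"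
    using below below' at pos [of "\<phi> + of_int k * t"]
    by (auto simp: H_def inner_diff_left mult.commute [of "?g j"] less_imp_le mult_left_mono)
  then have "sector t (\<phi> + of_int k * t) \<subseteq> H"
    unfolding sector_def using \<open>convex H\<close> by (rule hull_minimal)
  then show "?u k \<bullet> x \<le> ?g k" "(?u j \<bullet> x) * ?g k \<le> (?u k \<bullet> x) * ?g j" "0 \<le> ?u k \<bullet> x"
    using x by (auto simp: H_def inner_diff_left mult.commute)
qed

lemma polygon_eq_Union:
  fixes m :: nat
  assumes m: "m \<ge> 2" and t: "t = pi / m" and pos: "\<And>\<psi>. g \<psi> > 0"
  shows "polygon g m \<phi> = (\<Union>k\<in>{0..<2 * int m}. sector t (\<phi> + of_int k * t))"
proof (intro equalityI subsetI)
  let ?u = "\<lambda>k::int. unit_dir (\<phi> + of_int k * t)" and ?g = "\<lambda>k::int. g (\<phi> + of_int k * t)"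
  fix x assume "x \<in> (\<Union>k\<in>{0..<2 * int m}. sector t (\<phi> + of_int k * t))"
  then obtain k where x: "x \<in> sector t (\<phi> + of_int k * t)" by blast
  have "?u j \<bullet> x \<le> ?g j" for j
  proof -
    have "(?u j \<bullet> x) * ?g k \<le> (?u k \<bullet> x) * ?g j"
      by (rule sector_normalized [OF m t pos x])
    also have "\<dots> \<le> ?g k * ?g j"
      by (intro mult_right_mono sector_normalized [OF m t pos x] less_imp_le [OF pos])
    finally show ?thesis using pos [of "\<phi> + of_int k * t"] by (simp add: mult.commute)
  qed
  then show "x \<in> polygon g m \<phi>" by (simp add: polygon_def t)
next
  let ?u = "\<lambda>k::int. unit_dir (\<phi> + of_int k * t)" and ?g = "\<lambda>k::int. g (\<phi> + of_int k * t)"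
  fix x assume "x \<in> polygon g m \<phi>"
  then have x: "?u j \<bullet> x \<le> ?g j" for j by (simp add: polygon_def t)
  have t0: "0 < t" "t < pi" using m by (auto simp: t field_simps)
  then have st: "sin t > 0" by (rule sin_gt_zero)
  \<comment> \<open>\<open>x\<close> lies in the sector of the side whose constraint is relatively tightest at \<open>x\<close>.\<close>
  define q where "q = (\<lambda>j. (?u j \<bullet> x) / ?g j)"
  have "Max (q ` {0..<2 * int m}) \<in> q ` {0..<2 * int m}" using m by (intro Max_in) auto
  then obtain k where k: "k \<in> {0..<2 * int m}" "Max (q ` {0..<2 * int m}) = q k" by auto
  have k_max: "q j \<le> q k" if "j \<in> {0..<2 * int m}" for j
    unfolding k(2) [symmetric] using that by (intro Max_ge) auto
  have q_le: "q j \<le> q k" for j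
  proof -
    have "q j = q (j mod (2 * int m))"
      using periodic_index [of m \<phi> j] m by (simp add: q_def t)
    also have "\<dots> \<le> q k" using m by (intro k_max) auto
    finally show ?thesis .
  qed
  \<comment> \<open>s is the gauge of x with respect to the polygon; the aim is to show that x lies
    on s times edge k.\<close>
  define s where "s = q k"
  have s1: "s \<le> 1" using x [of k] pos [of "\<phi> + of_int k * t"] by (simp add: s_def q_def)
  \<comment> \<open>The normals with indices 0 and m are opposite, so one of the two ratios is
    nonnegative, and s is the largest ratio.\<close>
  have s0: "s \<ge> 0"
  proof -
    have "?u (int m) = - ?u 0" using unit_dir_pi [of \<phi>] m by (simp add: t)
    then have "?u 0 \<bullet> x \<ge> 0 \<or> ?u (int m) \<bullet> x \<ge> 0" by auto
    then have "q 0 \<ge> 0 \<or> q (int m) \<ge> 0"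
      unfolding q_def using pos by (auto intro!: divide_nonneg_pos)
    then show ?thesis using q_le [of 0] q_le [of "int m"] unfolding s_def by linarith
  qed
  have le: "?u j \<bullet> x \<le> s * ?g j" for j
    using q_le [of j] pos [of "\<phi> + of_int j * t"] by (simp add: s_def q_def field_simps)
  define \<psi> where "\<psi> = \<phi> + of_int k * t"
  have eq: "unit_dir \<psi> \<bullet> x = s * g \<psi>"
    using pos [of \<psi>] by (simp add: s_def q_def \<psi>_def)
  define a b where "a = (g (\<psi> + t) - cos t * g \<psi>) / sin t"
    and "b = (g (\<psi> - t) - cos t * g \<psi>) / sin t"
  have v: "vertex t \<psi> = g \<psi> *\<^sub>R unit_dir \<psi> + a *\<^sub>R unit_dir (\<psi> + pi / 2)"
    "vertex t (\<psi> - t) = g \<psi> *\<^sub>R unit_dir \<psi> - b *\<^sub>R unit_dir (\<psi> + pi / 2)"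
    using st vertex_prev [of t \<psi>] by (simp_all add: vertex_def [of _ \<psi>] a_def b_def)
  define c where "c = unit_dir (\<psi> + pi / 2) \<bullet> x"
  have xc: "x = (s * g \<psi>) *\<^sub>R unit_dir \<psi> + c *\<^sub>R unit_dir (\<psi> + pi / 2)"
    using unit_dir_frame [of x \<psi>] by (simp add: eq c_def)
  have "unit_dir (\<psi> + t) \<bullet> x \<le> s * g (\<psi> + t)"
    using le [of "k + 1"] by (simp add: \<psi>_def algebra_simps)
  then have "cos t * (s * g \<psi>) + sin t * c \<le> s * g (\<psi> + t)"
    by (simp add: unit_dir_rotate [of \<psi> t] inner_add_left eq c_def)
  then have ca: "c \<le> s * a" using st by (simp add: a_def field_simps)
  have "unit_dir (\<psi> - t) \<bullet> x \<le> s * g (\<psi> - t)"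
    using le [of "k - 1"] by (simp add: \<psi>_def algebra_simps)
  then have "cos t * (s * g \<psi>) - sin t * c \<le> s * g (\<psi> - t)"
    using unit_dir_rotate [of \<psi> "-t"] by (simp add: inner_diff_left eq c_def)
  then have cb: "- (s * b) \<le> c" using st by (simp add: b_def field_simps)
  have "x \<in> sector t \<psi>"
  proof -
    \<comment> \<open>Along the scaled edge the tangential coordinate c runs from
      \<open>- (s * b)\<close> to \<open>s * a\<close>. The weights l and r split s between the two
      endpoints, and the origin receives 1 - s. An edge of length zero, and x at the apex, are
      separated because the quotients divide by a + b.\<close>
    obtain l r where lm: "l \<ge> 0" "r \<ge> 0" "l + r = s" "c = l * a - r * b"
    proof (cases "a + b = 0")
      case True
      then have "b = - a" by linarith
      show thesis using that [of s 0] s0 ca cb \<open>b = - a\<close> by simp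
    next
      case False
      have "0 \<le> s * (a + b)" using ca cb by (simp add: algebra_simps)
      show thesis
      proof (cases "s = 0")
        case True
        then show thesis using that [of 0 0] ca cb by simp
      next
        case False
        then have ab: "a + b > 0" using \<open>0 \<le> s * (a + b)\<close> s0 \<open>a + b \<noteq> 0\<close>
          by (simp add: zero_le_mult_iff)
        show thesis
        proof (rule that [of "(c + s * b) / (a + b)" "(s * a - c) / (a + b)"])
          show "(c + s * b) / (a + b) + (s * a - c) / (a + b) = s"
            using ab by (simp flip: add_divide_distrib) (simp flip: distrib_left add: add.commute)
          have *: "c * (a + b) = (c + s * b) * a - (s * a - c) * b" by (simp add: algebra_simps)
          have "(c + s * b) / (a + b) * a - (s * a - c) / (a + b) * b = c * (a + b) / (a + b)"
            unfolding * diff_divide_distrib [of "(c + s * b) * a"] by simp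
          then show "c = (c + s * b) / (a + b) * a - (s * a - c) / (a + b) * b"
            using ab by simp
        qed (use ca cb ab in auto)
      qed
    qed
    have "x = (1 - s) *\<^sub>R 0 + r *\<^sub>R vertex t (\<psi> - t) + l *\<^sub>R vertex t \<psi>"
      unfolding v by (subst xc) (simp add: lm(4) algebra_simps flip: lm(3))
    then show ?thesis
      unfolding sector_def convex_hull_3 mem_Collect_eq
      using lm s1 by (intro exI [of _ "1 - s"] exI [of _ r] exI [of _ l]) auto
  qed
  then show "x \<in> (\<Union>k\<in>{0..<2 * int m}. sector t (\<phi> + of_int k * t))"
    using k(1) by (auto simp: \<psi>_def)
qed

lemma measure_polygon:
  assumes m: "m \<ge> 2" and pos: "\<And>\<psi>. g \<psi> > 0"
  shows "polygon g m \<phi> \<in> lmeasurable"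
    and "measure lebesgue (polygon g m \<phi>) = edge_sum g m \<phi>"
proof -
  define t where "t = pi / m"
  have t: "0 < t" "t \<le> pi / 2" using m by (auto simp: t_def field_simps)
  have U: "polygon g m \<phi> = (\<Union>k\<in>{0..<2 * int m}. sector t (\<phi> + of_int k * t))"
    by (rule polygon_eq_Union [OF m t_def pos])
  have meas: "sector t \<psi> \<in> lmeasurable" for \<psi>
    unfolding sector_def
    by (intro lmeasurable_compact finite_imp_compact_convex_hull) auto
  then show "polygon g m \<phi> \<in> lmeasurable"
    unfolding U by (intro fmeasurable.finite_UN) auto
  \<comment> \<open>At a common point both directions attain the largest ratio, which gives one
    linear equation through the origin. It is nontrivial: otherwise comparing norms makes the
    support numbers equal, and then the normals.\<close>
  have negl: "negligible (sector t (\<phi> + of_int j * t) \<inter> sector t (\<phi> + of_int k * t))"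
    if "j \<in> {0..<2 * int m}" "k \<in> {0..<2 * int m}" "j \<noteq> k" for j k
  proof -
    let ?u = "\<lambda>k::int. unit_dir (\<phi> + of_int k * t)" and ?g = "\<lambda>k::int. g (\<phi> + of_int k * t)"
    have "?g k *\<^sub>R ?u j - ?g j *\<^sub>R ?u k \<noteq> 0"
    proof
      assume *: "?g k *\<^sub>R ?u j - ?g j *\<^sub>R ?u k = 0"
      then have "norm (?g k *\<^sub>R ?u j) = norm (?g j *\<^sub>R ?u k)" by simp
      then have "?g k = ?g j" using pos by (simp add: abs_of_pos)
      then have "?u j = ?u k" using * pos [of "\<phi> + of_int j * t"] by simp
      then show False using unit_dir_eq_imp that unfolding t_def by blast
    qed
    then have "negligible {x. (?g k *\<^sub>R ?u j - ?g j *\<^sub>R ?u k) \<bullet> x = 0}"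
      by (intro negligible_hyperplane) auto
    then show ?thesis
    proof (rule negligible_subset)
      show "sector t (\<phi> + of_int j * t) \<inter> sector t (\<phi> + of_int k * t)
        \<subseteq> {x. (?g k *\<^sub>R ?u j - ?g j *\<^sub>R ?u k) \<bullet> x = 0}"
      proof
        fix x assume "x \<in> sector t (\<phi> + of_int j * t) \<inter> sector t (\<phi> + of_int k * t)"
        then show "x \<in> {x. (?g k *\<^sub>R ?u j - ?g j *\<^sub>R ?u k) \<bullet> x = 0}"
          using sector_normalized(2) [OF m t_def pos, of x \<phi> j k]
            sector_normalized(2) [OF m t_def pos, of x \<phi> k j]
          by (simp add: inner_diff_left mult.commute)
      qed
    qed
  qed
  have "measure lebesgue (polygon g m \<phi>)
     = (\<Sum>k\<in>{0..<2 * int m}. measure lebesgue (sector t (\<phi> + of_int k * t)))"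
    unfolding U by (intro measure_negligible_finite_Union_image meas)
      (auto simp: pairwise_def intro!: negl)
  also have "\<dots> = (\<Sum>k\<in>{0..<2 * int m}. edge_term g t (\<phi> + of_int k * t) / 2)"
    by (intro sum.cong refl content_sector [OF t] less_imp_le [OF pos])
  finally show "measure lebesgue (polygon g m \<phi>) = edge_sum g m \<phi>"
    by (simp add: edge_sum_def t_def sum_divide_distrib)
qed

end

section \<open>Support functions\<close>

lemma supp_fun_upper:
  assumes "convex_body K" "x \<in> K"
  shows "unit_dir \<phi> \<bullet> x \<le> supp_fun \<phi> K"
proof -
  have "compact ((\<lambda>x. unit_dir \<phi> \<bullet> x) ` K)"
    using assms by (intro compact_continuous_image continuous_intros) (auto simp: convex_body_def)
  then have "bdd_above ((\<lambda>x. unit_dir \<phi> \<bullet> x) ` K)"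
    by (intro bounded_imp_bdd_above compact_imp_bounded)
  then show ?thesis unfolding supp_fun_def using assms by (intro cSUP_upper)
qed

lemma supp_fun_least:
  assumes "convex_body K" "\<And>x. x \<in> K \<Longrightarrow> unit_dir \<phi> \<bullet> x \<le> c"
  shows "supp_fun \<phi> K \<le> c"
  unfolding supp_fun_def using assms by (intro cSUP_least) (auto simp: convex_body_def)

lemma supp_fun_attained:
  assumes "convex_body K"
  obtains x where "x \<in> K" "supp_fun \<phi> K = unit_dir \<phi> \<bullet> x"
proof -
  obtain x where "x \<in> K" "\<forall>y\<in>K. unit_dir \<phi> \<bullet> y \<le> unit_dir \<phi> \<bullet> x"
    using assms continuous_attains_sup [of K "\<lambda>x. unit_dir \<phi> \<bullet> x"]
    by (auto simp: convex_body_def continuous_intros)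
  then show thesis
    using that supp_fun_upper [OF assms] supp_fun_least [OF assms, of \<phi> "unit_dir \<phi> \<bullet> x"]
    by (meson antisym)
qed

lemma supp_fun_2pi: "supp_fun (\<phi> + 2 * pi) K = supp_fun \<phi> K"
  by (simp add: supp_fun_def)

text \<open>At a point of K extremal for the middle direction, \<open>unit_dir_subconvex\<close>
  gives an equality; the outer terms only grow when replaced by the support function, as their
  coefficients are nonnegative.\<close>

lemma supp_fun_subconvex:
  assumes K: "convex_body K" and "0 \<le> \<alpha>" "0 \<le> \<beta>" "\<alpha> + \<beta> \<le> pi"
  shows "sin (\<alpha> + \<beta>) * supp_fun \<phi> K
    \<le> sin \<beta> * supp_fun (\<phi> - \<alpha>) K + sin \<alpha> * supp_fun (\<phi> + \<beta>) K"
proof -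
  obtain x where x: "x \<in> K" "supp_fun \<phi> K = unit_dir \<phi> \<bullet> x"
    using supp_fun_attained [OF K] .
  have "sin (\<alpha> + \<beta>) * (unit_dir \<phi> \<bullet> x)
     = sin \<beta> * (unit_dir (\<phi> - \<alpha>) \<bullet> x) + sin \<alpha> * (unit_dir (\<phi> + \<beta>) \<bullet> x)"
    using arg_cong [OF unit_dir_subconvex [of \<alpha> \<beta> \<phi>], of "\<lambda>y. y \<bullet> x"]
    by (simp add: inner_add_left)
  also have "\<dots> \<le> sin \<beta> * supp_fun (\<phi> - \<alpha>) K + sin \<alpha> * supp_fun (\<phi> + \<beta>) K"
    using assms by (intro add_mono mult_left_mono supp_fun_upper K x sin_ge_zero) auto
  finally show ?thesis by (simp add: x(2))
qed

text \<open>Adding \<epsilon> is passing to the parallel body at distance \<epsilon>. Constants are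
  subconvex because sine is subadditive on these angles. For K containing the origin, \<epsilon> > 0
  makes the support numbers positive.\<close>

lemma circumscribing_supp_fun:
  assumes K: "convex_body K" and "\<epsilon> \<ge> 0"
  shows "circumscribing (\<lambda>\<phi>. supp_fun \<phi> K + \<epsilon>)"
proof
  fix \<alpha> \<beta> \<phi> :: real assume ab: "0 \<le> \<alpha>" "0 \<le> \<beta>" "\<alpha> + \<beta> \<le> pi"
  have "sin (\<alpha> + \<beta>) \<le> sin \<beta> + sin \<alpha>"
  proof -
    have "sin \<alpha> * cos \<beta> \<le> sin \<alpha> * 1" "cos \<alpha> * sin \<beta> \<le> 1 * sin \<beta>"
      using ab
      by (simp_all only: mult_left_mono [OF cos_le_one] mult_right_mono [OF cos_le_one] sin_ge_zero)
    then show ?thesis by (simp add: sin_add)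
  qed
  then have "sin (\<alpha> + \<beta>) * \<epsilon> \<le> (sin \<beta> + sin \<alpha>) * \<epsilon>"
    using \<open>\<epsilon> \<ge> 0\<close> by (rule mult_right_mono)
  then show "sin (\<alpha> + \<beta>) * (supp_fun \<phi> K + \<epsilon>)
    \<le> sin \<beta> * (supp_fun (\<phi> - \<alpha>) K + \<epsilon>) + sin \<alpha> * (supp_fun (\<phi> + \<beta>) K + \<epsilon>)"
    using supp_fun_subconvex [OF K ab, of \<phi>] by (simp add: algebra_simps)
qed (simp add: supp_fun_2pi)

lemma supp_fun_lipschitz:
  assumes K: "convex_body K" and R: "\<And>x. x \<in> K \<Longrightarrow> norm x \<le> R"
  shows "supp_fun \<phi> K \<le> supp_fun \<psi> K + R * \<bar>\<phi> - \<psi>\<bar>"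
proof -
  obtain x where x: "x \<in> K" "supp_fun \<phi> K = unit_dir \<phi> \<bullet> x"
    using supp_fun_attained [OF K] .
  have "(unit_dir \<phi> - unit_dir \<psi>) \<bullet> x \<le> norm (unit_dir \<phi> - unit_dir \<psi>) * norm x"
    by (rule norm_cauchy_schwarz)
  also have "\<dots> \<le> \<bar>\<phi> - \<psi>\<bar> * R"
    by (intro mult_mono dist_unit_dir_le R x) auto
  finally show ?thesis
    using supp_fun_upper [OF K x(1), of \<psi>] by (simp add: x(2) inner_diff_left algebra_simps)
qed

lemma convex_body_bounded:
  assumes "convex_body K"
  obtains R where "R \<ge> 0" "\<And>x. x \<in> K \<Longrightarrow> norm x \<le> R"
proof -
  have "bounded K" using assms by (auto simp: convex_body_def compact_imp_bounded)
  then obtain R where "R > 0" "\<forall>x\<in>K. norm x \<le> R" unfolding bounded_pos by blast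
  then show thesis using that [of R] by auto
qed

lemma continuous_on_supp_fun:
  assumes K: "convex_body K"
  shows "continuous_on S (\<lambda>\<phi>. supp_fun \<phi> K)"
proof -
  obtain R where R: "R \<ge> 0" "\<And>x. x \<in> K \<Longrightarrow> norm x \<le> R"
    using convex_body_bounded [OF K] by blast
  have "R-lipschitz_on S (\<lambda>\<phi>. supp_fun \<phi> K)"
  proof (rule lipschitz_onI)
    fix \<phi> \<psi>
    show "dist (supp_fun \<phi> K) (supp_fun \<psi> K) \<le> R * dist \<phi> \<psi>"
      using supp_fun_lipschitz [OF K R(2), of \<phi> \<psi>] supp_fun_lipschitz [OF K R(2), of \<psi> \<phi>]
      by (simp add: dist_real_def abs_minus_commute)
  qed (rule R)
  then show ?thesis by (rule lipschitz_on_continuous_on)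
qed

text \<open>The direction from the closest point y towards x decides: K is supported at y in that
  direction, so x exceeds the support function there by exactly its distance to K.\<close>

lemma infdist_le_supp_fun:
  assumes K: "convex_body K" and "\<delta> \<ge> 0"
    and x: "\<And>\<phi>. unit_dir \<phi> \<bullet> x \<le> supp_fun \<phi> K + \<delta>"
  shows "infdist x K \<le> \<delta>"
proof -
  have K': "convex K" "closed K" "K \<noteq> {}" using K by (auto simp: convex_body_def compact_imp_closed)
  define y where "y = closest_point K x"
  have y: "y \<in> K" using K' by (simp add: y_def closest_point_in_set)
  obtain \<phi> where \<phi>: "x - y = norm (x - y) *\<^sub>R unit_dir \<phi>" by (rule exists_unit_dir)
  have "norm (x - y) \<le> \<delta>"
  proof (cases "x = y")
    case True
    then show ?thesis using \<open>\<delta> \<ge> 0\<close> by simp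
  next
    case False
    have "unit_dir \<phi> \<bullet> z \<le> unit_dir \<phi> \<bullet> y" if "z \<in> K" for z
    proof -
      have "(x - y) \<bullet> (z - y) \<le> 0" unfolding y_def
        by (rule closest_point_dot) (use K' that in auto)
      then have "norm (x - y) * (unit_dir \<phi> \<bullet> (z - y)) \<le> 0" by (subst (asm) \<phi>) simp
      then show ?thesis using False by (simp add: mult_le_0_iff inner_diff_right)
    qed
    then have "supp_fun \<phi> K \<le> unit_dir \<phi> \<bullet> y" by (rule supp_fun_least [OF K])
    moreover have "unit_dir \<phi> \<bullet> x - unit_dir \<phi> \<bullet> y = norm (x - y)"
      using arg_cong [OF \<phi>, of "\<lambda>v. unit_dir \<phi> \<bullet> v"]
      by (simp add: inner_diff_right inner_unit_dir)
    ultimately show ?thesis using x [of \<phi>] by linarith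
  qed
  then show ?thesis using infdist_le [OF y, of x] by (simp add: dist_norm)
qed

section \<open>Parallel bodies and convergence of the circumscribed areas\<close>

definition neighbourhood :: "real \<Rightarrow> 'a::metric_space set \<Rightarrow> 'a set" where
  "neighbourhood \<delta> K = {x. infdist x K \<le> \<delta>}"

lemma compact_neighbourhood:
  assumes "convex_body K"
  shows "compact (neighbourhood \<delta> K)"
proof -
  \<comment> \<open>\<open>compact_infdist_le\<close> asks for a positive radius; intersecting with
    the larger set also covers \<delta> \<le> 0.\<close>
  have "compact (neighbourhood (max 1 \<delta>) K)" unfolding neighbourhood_def
    using assms by (intro compact_infdist_le) (auto simp: convex_body_def)
  moreover have "closed (neighbourhood \<delta> K)" unfolding neighbourhood_def
    by (intro closed_Collect_le continuous_intros)
  moreover have "neighbourhood \<delta> K = neighbourhood \<delta> K \<inter> neighbourhood (max 1 \<delta>) K"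
    by (auto simp: neighbourhood_def)
  ultimately show ?thesis by (metis closed_Int_compact)
qed

text \<open>Continuity of the measure from above: K is closed, so the shrinking neighbourhoods
  intersect in K itself.\<close>

lemma measure_neighbourhood_tendsto:
  assumes K: "convex_body K" and \<delta>: "decseq \<delta>" "\<delta> \<longlonglongrightarrow> 0"
  shows "(\<lambda>n. measure lebesgue (neighbourhood (\<delta> n) K)) \<longlonglongrightarrow> measure lebesgue K"
proof -
  have "(\<Inter>n. neighbourhood (\<delta> n) K) = K"
  proof (intro equalityI subsetI)
    fix x assume "x \<in> (\<Inter>n. neighbourhood (\<delta> n) K)"
    then have "infdist x K \<le> \<delta> n" for n by (auto simp: neighbourhood_def)
    then have "infdist x K \<le> 0" using \<delta>(2) by (intro LIMSEQ_le_const) auto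
    then have "infdist x K = 0" using infdist_nonneg [of x K] by linarith
    then show "x \<in> K"
      using K in_closed_iff_infdist_zero [of K x] by (simp add: convex_body_def compact_imp_closed)
  next
    fix x assume "x \<in> K"
    moreover have "\<delta> n \<ge> 0" for n using decseq_ge [OF \<delta>] .
    ultimately show "x \<in> (\<Inter>n. neighbourhood (\<delta> n) K)" by (simp add: neighbourhood_def)
  qed
  moreover have "(\<lambda>n. measure lebesgue (neighbourhood (\<delta> n) K))
     \<longlonglongrightarrow> measure lebesgue (\<Inter>n. neighbourhood (\<delta> n) K)"
  proof (rule Lim_measure_decseq)
    show "range (\<lambda>n. neighbourhood (\<delta> n) K) \<subseteq> sets lebesgue"
      using lmeasurable_compact [OF compact_neighbourhood [OF K]] by auto
    show "decseq (\<lambda>n. neighbourhood (\<delta> n) K)"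
      using \<delta>(1) by (fastforce simp: decseq_def neighbourhood_def)
    show "emeasure lebesgue (neighbourhood (\<delta> n) K) \<noteq> \<infinity>" for n
      using fmeasurableD2 [OF lmeasurable_compact [OF compact_neighbourhood [OF K]]] by simp
  qed
  ultimately show ?thesis by simp
qed

lemma measure_le_circumscribed:
  assumes K: "convex_body K" and K0: "0 \<in> K" and R: "\<And>x. x \<in> K \<Longrightarrow> norm x \<le> R"
    and m: "m \<ge> 8" and t: "t = pi / real m" and \<epsilon>: "0 < \<epsilon>" "\<epsilon> \<le> 1"
  defines "S \<equiv> \<lambda>\<phi>. edge_sum (\<lambda>\<phi>. supp_fun \<phi> K + \<epsilon>) m \<phi>"
  shows "measure lebesgue K \<le> S \<phi>"
    and "S \<phi> \<le> measure lebesgue (neighbourhood (\<epsilon> + t * (4 * R + 2)) K)"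
proof -
  define g where "g = (\<lambda>\<phi>. supp_fun \<phi> K + \<epsilon>)"
  interpret circumscribing g
    unfolding g_def using \<epsilon> by (intro circumscribing_supp_fun K) auto
  have m2: "m \<ge> 2" using m by simp
  have h0: "supp_fun \<psi> K \<ge> 0" for \<psi> using supp_fun_upper [OF K K0, of \<psi>] by simp
  then have pos: "g \<psi> > 0" for \<psi> using \<epsilon> by (simp add: g_def add_nonneg_pos)
  have S: "measure lebesgue (polygon g m \<phi>) = S \<phi>"
    using measure_polygon(2) [OF m2 pos, of \<phi>] unfolding S_def g_def t by simp
  have R0: "R \<ge> 0" using R [OF K0] by simp
  have t0: "0 < t" "t \<le> 1 / 2"
    using m pi_less_4 by (auto simp: t field_simps)
  have "K \<subseteq> polygon g m \<phi>"
    using \<epsilon> by (auto simp: polygon_def g_def intro!: add_increasing2 supp_fun_upper [OF K])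
  then show "measure lebesgue K \<le> S \<phi>"
    unfolding S [symmetric] using K measure_polygon(1) [OF m2 pos, of \<phi>]
    by (intro measure_mono_fmeasurable)
      (auto simp: convex_body_def intro: fmeasurableD lmeasurable_compact)
  have "polygon g m \<phi> \<subseteq> neighbourhood (\<epsilon> + t * (4 * R + 2)) K"
  proof
    fix x assume x: "x \<in> polygon g m \<phi>"
    \<comment> \<open>Rounding \<psi> down to a normal \<eta> of the polygon moves the angle by at
      most t; \<open>R * t\<close> is the cost for the support function, \<open>t * norm x\<close>
      the cost for the inner product.\<close>
    have dir: "unit_dir \<psi> \<bullet> x \<le> supp_fun \<psi> K + R * t + \<epsilon> + t * norm x" for \<psi>
    proof -
      define k where "k = \<lfloor>(\<psi> - \<phi>) / t\<rfloor>"
      define \<eta> where "\<eta> = \<phi> + of_int k * t"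
      have "of_int k \<le> (\<psi> - \<phi>) / t" "(\<psi> - \<phi>) / t < of_int k + 1"
        unfolding k_def by linarith+
      then have "\<eta> \<le> \<psi>" "\<psi> \<le> \<eta> + t" using t0 by (auto simp: \<eta>_def field_simps)
      then have \<eta>: "\<bar>\<psi> - \<eta>\<bar> \<le> t" by simp
      have "unit_dir \<eta> \<bullet> x \<le> supp_fun \<eta> K + \<epsilon>"
        using x by (auto simp: polygon_def g_def \<eta>_def t)
      moreover have "supp_fun \<eta> K \<le> supp_fun \<psi> K + R * t"
        using supp_fun_lipschitz [OF K R, of \<eta> \<psi>] mult_left_mono [OF \<eta> R0]
        by (simp add: abs_minus_commute)
      moreover have "(unit_dir \<psi> - unit_dir \<eta>) \<bullet> x \<le> t * norm x"
        using norm_cauchy_schwarz [of "unit_dir \<psi> - unit_dir \<eta>" x]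
          mult_right_mono [OF order_trans [OF dist_unit_dir_le \<eta>], of "norm x"] by simp
      ultimately show ?thesis by (simp add: inner_diff_left)
    qed
    \<comment> \<open>The bound contains \<open>norm x\<close> itself. With t \<le> 1 / 2, which is
      why m \<ge> 8, it reads norm x \<le> R + R / 2 + 1 + norm x / 2, so norm x \<le> 3 R + 2; then
      R t + t (3 R + 2) is the t (4 R + 2) of the claim.\<close>
    have Rt: "R * t \<le> R * (1 / 2)" "norm x * t \<le> norm x * (1 / 2)"
      using t0 R0 by (intro mult_left_mono; simp)+
    obtain \<psi> where \<psi>: "x = norm x *\<^sub>R unit_dir \<psi>" by (rule exists_unit_dir)
    have "norm x = unit_dir \<psi> \<bullet> x"
      using arg_cong [OF \<psi>, of "\<lambda>v. unit_dir \<psi> \<bullet> v"] by (simp add: inner_unit_dir)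
    moreover have "supp_fun \<psi> K \<le> R"
      by (intro supp_fun_least [OF K] order_trans [OF norm_cauchy_schwarz]) (simp add: R)
    ultimately have nx: "norm x \<le> 3 * R + 2"
      using dir [of \<psi>] Rt \<epsilon> by (simp add: mult.commute)
    have "unit_dir \<psi> \<bullet> x \<le> supp_fun \<psi> K + (\<epsilon> + t * (4 * R + 2))" for \<psi>
      using dir [of \<psi>] mult_left_mono [OF nx, of t] t0 by (simp add: algebra_simps)
    then show "x \<in> neighbourhood (\<epsilon> + t * (4 * R + 2)) K"
      unfolding neighbourhood_def using infdist_le_supp_fun [OF K] \<epsilon> t0 R0 by simp
  qed
  then show "S \<phi> \<le> measure lebesgue (neighbourhood (\<epsilon> + t * (4 * R + 2)) K)"
    unfolding S [symmetric]
    using measure_polygon(1) [OF m2 pos, of \<phi>] lmeasurable_compact [OF compact_neighbourhood [OF K]]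
    by (intro measure_mono_fmeasurable) (auto intro: fmeasurableD)
qed

text \<open>For fixed m the polygon formula is continuous in \<epsilon>, so the bounds survive the
  limit from the right, even where the support numbers of K vanish.\<close>

lemma measure_le_edge_sum:
  assumes K: "convex_body K" and K0: "0 \<in> K" and R: "\<And>x. x \<in> K \<Longrightarrow> norm x \<le> R"
    and m: "m \<ge> 8" and t: "t = pi / real m"
  defines "S \<equiv> \<lambda>\<phi>. edge_sum (\<lambda>\<phi>. supp_fun \<phi> K) m \<phi>"
  shows "measure lebesgue K \<le> S \<phi>"
    and "S \<phi> \<le> measure lebesgue (neighbourhood (2 * t * (4 * R + 2)) K)"
proof -
  define T where "T = (\<lambda>\<epsilon>. edge_sum (\<lambda>\<phi>. supp_fun \<phi> K + \<epsilon>) m \<phi>)"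
  have st: "sin t \<noteq> 0" using m sin_gt_zero [of t] by (auto simp: t field_simps)
  have "continuous_on UNIV T"
    unfolding T_def edge_sum_def edge_term_def t [symmetric] by (intro continuous_intros) (use st in auto)
  then have "isCont T 0" by (simp add: continuous_on_eq_continuous_at)
  then have lim: "(T \<longlongrightarrow> S \<phi>) (at_right 0)"
    unfolding isCont_def filterlim_at_split by (simp add: T_def S_def)
  have R0: "R \<ge> 0" using R [OF K0] by simp
  \<comment> \<open>Below d the enlargement \<epsilon> is at most another t (4 R + 2), which
    explains the factor 2 in the claimed radius.\<close>
  define d where "d = min 1 (t * (4 * R + 2))"
  have d: "d > 0" using R0 m by (auto simp: d_def t intro!: divide_pos_pos mult_pos_pos)
  have ev: "\<forall>\<^sub>F \<epsilon> in at_right 0. 0 < \<epsilon> \<and> \<epsilon> < d"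
    using eventually_at_right_less [of "0::real"] eventually_at_right [OF d] d
    by (auto simp: eventually_conj_iff intro: exI [of _ d])
  show "measure lebesgue K \<le> S \<phi>"
  proof (rule tendsto_lowerbound [OF lim])
    show "\<forall>\<^sub>F \<epsilon> in at_right 0. measure lebesgue K \<le> T \<epsilon>"
      using ev by eventually_elim
        (auto simp: T_def d_def intro!: measure_le_circumscribed(1) [OF K K0 R m t])
  qed simp
  show "S \<phi> \<le> measure lebesgue (neighbourhood (2 * t * (4 * R + 2)) K)"
  proof (rule tendsto_upperbound [OF lim])
    show "\<forall>\<^sub>F \<epsilon> in at_right 0. T \<epsilon> \<le> measure lebesgue (neighbourhood (2 * t * (4 * R + 2)) K)"
      using ev
    proof eventually_elim
      case (elim \<epsilon>)
      have "T \<epsilon> \<le> measure lebesgue (neighbourhood (\<epsilon> + t * (4 * R + 2)) K)"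
        unfolding T_def using elim by (intro measure_le_circumscribed(2) K K0 R m t) (auto simp: d_def)
      also have "\<dots> \<le> measure lebesgue (neighbourhood (2 * t * (4 * R + 2)) K)"
      proof (rule measure_mono_fmeasurable)
        show "neighbourhood (\<epsilon> + t * (4 * R + 2)) K \<subseteq> neighbourhood (2 * t * (4 * R + 2)) K"
          using elim by (auto simp: neighbourhood_def d_def)
      qed (auto intro: fmeasurableD lmeasurable_compact compact_neighbourhood K)
      finally show ?case .
    qed
  qed simp
qed

section \<open>The area of a convex body\<close>

lemma sin_mult_over_tendsto:
  "((\<lambda>x. sin (a * x) / x) \<longlongrightarrow> a) (at (0::real))"
proof -
  have "((\<lambda>x. sin (a * x)) has_field_derivative a) (at 0)"
    by (auto intro!: derivative_eq_intros)
  then show ?thesis by (simp add: DERIV_def)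
qed

lemma one_minus_cos: "1 - cos x = 2 * (sin (x / 2))\<^sup>2" for x :: real
  using cos_double_sin [of "x / 2"] by simp

lemma two_minus_two_cos_over_tendsto:
  "((\<lambda>x. 2 * (1 - cos (a * x)) / x\<^sup>2) \<longlongrightarrow> a\<^sup>2) (at (0::real))"
proof -
  have "((\<lambda>x. (2 * (sin (a / 2 * x) / x))\<^sup>2) \<longlongrightarrow> (2 * (a / 2))\<^sup>2) (at 0)"
    by (intro tendsto_intros sin_mult_over_tendsto)
  then show ?thesis by (simp add: one_minus_cos power_mult_distrib power_divide)
qed

text \<open>The hypothesis is the spectral form of the mean area of circumscribed \<open>2 m\<close>-gons. Since it
  yields bounded partial sums of \<open>n\<^sup>2 * a n\<close>, summability needs no regularity of the support function.\<close>

lemma has_sum_one_minus_square: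
  fixes a :: "int \<Rightarrow> real" and t :: "nat \<Rightarrow> real"
  assumes a: "\<And>n. a n \<ge> 0" "(a has_sum s) UNIV"
    and t: "\<And>m. 0 < t m" "t \<longlonglongrightarrow> 0"
    and B: "B \<longlonglongrightarrow> b"
    and sum: "\<And>m. ((\<lambda>n. a n * (cos (of_int n * t m) - cos (t m))) has_sum sin (t m) * t m * B m) UNIV"
  shows "((\<lambda>n. (1 - (of_int n)\<^sup>2) * a n) has_sum 2 * b) UNIV"
proof -
  \<comment> \<open>\<open>d m n\<close> is n^2 seen at scale \<open>t m\<close>; \<open>L m\<close>
    is the sum of \<open>d m n * a n\<close> as computed from the hypothesis
    \<open>sum\<close>.\<close>
  define d where "d = (\<lambda>m (n::int). 2 * (1 - cos (of_int n * t m)) / (t m)\<^sup>2)"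
  define L where "L = (\<lambda>m. 2 / (t m)\<^sup>2 * ((1 - cos (t m)) * s - sin (t m) * t m * B m))"
  have t_at: "filterlim t (at 0) sequentially"
    using t by (auto simp: filterlim_at eventually_sequentially less_imp_neq [symmetric])
  have d_lim: "(\<lambda>m. d m n) \<longlonglongrightarrow> (of_int n)\<^sup>2" for n
    unfolding d_def by (rule filterlim_compose [OF two_minus_two_cos_over_tendsto t_at])
  have d_nonneg: "d m n \<ge> 0" for m n unfolding d_def by simp
  have d_le: "d m n \<le> (of_int n)\<^sup>2" for m n
  proof -
    have "\<bar>sin (of_int n * t m / 2)\<bar> \<le> \<bar>of_int n * t m / 2\<bar>" by (rule abs_sin_x_le_abs_x)
    then have "(sin (of_int n * t m / 2))\<^sup>2 \<le> (of_int n * t m / 2)\<^sup>2"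
      by (simp only: abs_le_square_iff)
    then have "2 * (1 - cos (of_int n * t m)) \<le> (of_int n)\<^sup>2 * (t m)\<^sup>2"
      by (simp add: one_minus_cos power_mult_distrib power_divide)
    then show ?thesis using t(1) [of m] by (simp add: d_def divide_le_eq)
  qed
  have d_sum: "((\<lambda>n. d m n * a n) has_sum L m) UNIV" for m
  proof -
    have "((\<lambda>n. 2 / (t m)\<^sup>2 * ((1 - cos (t m)) * a n + - (a n * (cos (of_int n * t m) - cos (t m)))))
        has_sum 2 / (t m)\<^sup>2 * ((1 - cos (t m)) * s + - (sin (t m) * t m * B m))) UNIV"
      by (intro has_sum_cmult_right has_sum_add has_sum_uminusI a(2) sum)
    moreover have "2 / (t m)\<^sup>2 * ((1 - cos (t m)) * a n + - (a n * (cos (of_int n * t m) - cos (t m))))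
        = d m n * a n" for n
    proof -
      have "(1 - cos (t m)) * a n + - (a n * (cos (of_int n * t m) - cos (t m)))
          = (1 - cos (of_int n * t m)) * a n"
        by (simp add: algebra_simps)
      then show ?thesis by (simp only: d_def) simp
    qed
    ultimately show ?thesis by (simp only: L_def diff_conv_add_uminus [of "_ * s"])
  qed
  have L_lim: "L \<longlonglongrightarrow> s - 2 * b"
  proof -
    have "(\<lambda>m. 2 * (1 - cos (1 * t m)) / (t m)\<^sup>2 * s - 2 * (sin (1 * t m) / t m) * B m)
        \<longlonglongrightarrow> 1\<^sup>2 * s - 2 * 1 * b"
      by (intro tendsto_intros B filterlim_compose [OF two_minus_two_cos_over_tendsto t_at]
         filterlim_compose [OF sin_mult_over_tendsto t_at])
    moreover have "2 * (1 - cos (1 * t m)) / (t m)\<^sup>2 * s - 2 * (sin (1 * t m) / t m) * B m = L m" for m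
      using t(1) [of m] by (simp add: L_def field_simps power2_eq_square)
    ultimately show ?thesis by simp
  qed
  define f where "f = (\<lambda>n. (of_int n)\<^sup>2 * a n)"
  \<comment> \<open>Fatou's argument: finite sums of nonnegative terms stay below
    \<open>L m\<close>, and then pass to the limit.\<close>
  have fin: "sum f F \<le> s - 2 * b" if "finite F" for F
  proof (rule LIMSEQ_le [OF _ L_lim])
    show "(\<lambda>m. \<Sum>n\<in>F. d m n * a n) \<longlonglongrightarrow> sum f F"
      unfolding f_def by (intro tendsto_intros d_lim)
    show "\<exists>N. \<forall>m\<ge>N. (\<Sum>n\<in>F. d m n * a n) \<le> L m"
      using finite_sum_le_has_sum [OF d_sum that] d_nonneg a by simp
  qed
  have "f summable_on UNIV"
    using fin a by (intro nonneg_bdd_above_summable_on bdd_aboveI [of _ "s - 2 * b"])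
      (auto simp: f_def)
  then obtain q where q: "(f has_sum q) UNIV" unfolding summable_on_def by blast
  have "q \<le> s - 2 * b"
    using q unfolding has_sum_def
    by (rule tendsto_upperbound) (auto simp: fin intro!: eventually_finite_subsets_at_top_weakI)
  \<comment> \<open>Conversely \<open>d m n\<close> is dominated by n^2, so the limit of L cannot
    exceed the full sum.\<close>
  moreover have "L m \<le> q" for m
    using d_sum q by (rule has_sum_mono) (simp add: f_def mult_right_mono d_le a)
  then have "s - 2 * b \<le> q" using L_lim by (intro LIMSEQ_le_const2) auto
  ultimately have "q = s - 2 * b" by simp
  with q a(2) have "((\<lambda>n. a n + - f n) has_sum s + - (s - 2 * b)) UNIV"
    by (intro has_sum_add has_sum_uminusI) auto
  then show ?thesis by (simp add: f_def algebra_simps)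
qed

lemma supp_coeff_eq: "supp_coeff K n = fourier_coeff (\<lambda>\<phi>. of_real (supp_fun \<phi> K)) n"
  by (simp add: supp_coeff_def fourier_coeff_def expi_def)

section \<open>The mean area of the polygons\<close>

lemma continuous_on_edge_term:
  assumes h: "continuous_on UNIV h" and "sin t \<noteq> 0"
  shows "continuous_on S (edge_term h t)"
proof -
  have "continuous_on S (\<lambda>x. h (x + c))" "continuous_on S h" "continuous_on S (\<lambda>x. h (x - c))" for c
    by (auto intro!: continuous_on_compose2 [OF h] continuous_intros continuous_on_subset [OF h])
  then show ?thesis
    unfolding edge_term_def using \<open>sin t \<noteq> 0\<close> by (intro continuous_intros) auto
qed

lemma continuous_on_edge_sum:
  assumes h: "continuous_on UNIV h" and m: "m \<ge> 2"
  shows "continuous_on S (edge_sum h m)"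
proof -
  have "sin (pi / m) > 0" using m by (intro sin_gt_zero) (auto simp: field_simps)
  then have "continuous_on UNIV (edge_term h (pi / m))"
    by (intro continuous_on_edge_term h) simp
  then have "continuous_on S (\<lambda>x. edge_term h (pi / m) (x + c))" for c
    by (rule continuous_on_compose2) (auto intro!: continuous_intros)
  then show ?thesis
    unfolding edge_sum_def by (intro continuous_intros) auto
qed

text \<open>Integrated over a full turn, the 2 m edge terms become equal by periodicity, and a
  single one is a combination of autocorrelations at the lags t, -t and 0, to which Parseval's
  identity applies.\<close>

lemma mean_edge_sum:
  fixes h :: "real \<Rightarrow> real"
  assumes h: "continuous_on UNIV h" and per: "\<And>x. h (x + 2 * pi) = h x" and m: "m \<ge> 2"
    and t: "t = pi / real m"
  shows "((\<lambda>n. (cmod (fourier_coeff (\<lambda>x. of_real (h x)) n))\<^sup>2 * (cos (of_int n * t) - cos t))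
     has_sum sin t * t * (1 / (4 * pi\<^sup>2) * integral {-pi..pi} (edge_sum h m))) UNIV"
proof -
  define a where "a = (\<lambda>n. (cmod (fourier_coeff (\<lambda>x. of_real (h x)) n))\<^sup>2)"
  have st: "sin t > 0" using m by (intro sin_gt_zero) (auto simp: t field_simps)
  have h': "continuous_on S (\<lambda>x. h (x + c))" "continuous_on S h" "continuous_on S (\<lambda>x. h (x - c))" for S c
    by (auto intro!: continuous_on_compose2 [OF h] continuous_intros)
  have int: "g integrable_on {-pi..pi}" if "continuous_on UNIV g" for g :: "real \<Rightarrow> real"
    by (intro integrable_continuous_interval continuous_on_subset [OF that]) auto
  have ce: "continuous_on S (edge_term h t)" for S
    using st by (intro continuous_on_edge_term h) simp
  have ps: "h (x + 2 * pi + c) = h (x + c)" "h (x + 2 * pi - c) = h (x - c)" for x c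
    using per [of "x + c"] per [of "x - c"] by (simp_all add: algebra_simps)
  have pe: "edge_term h t (x + 2 * pi) = edge_term h t x" for x
    by (simp add: edge_term_def per ps)
  have "integral {-pi..pi} (edge_sum h m)
     = (\<Sum>k\<in>{0..<2 * int m}. integral {-pi..pi} (\<lambda>x. edge_term h t (x + of_int k * t))) / 2"
    unfolding edge_sum_def t [symmetric]
    by (subst integral_divide, subst integral_sum)
       (auto intro!: int continuous_on_compose2 [OF ce] continuous_intros)
  also have "\<dots> = m * integral {-pi..pi} (edge_term h t)"
    by (simp add: integral_periodic_shift [OF ce pe])
  finally have es: "integral {-pi..pi} (edge_sum h m) = m * integral {-pi..pi} (edge_term h t)" .
  define J where "J = (\<lambda>c. integral {-pi..pi} (\<lambda>x. h x * h (x + c)))"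
  have "integral {-pi..pi} (edge_term h t) = (J t + J (- t) - 2 * cos t * J 0) / sin t"
    unfolding edge_term_def J_def
  proof (rule integral_unique)
    have "((\<lambda>x. (h x * h (x + t) + h x * h (x + - t) - 2 * cos t * (h x * h (x + 0))) / sin t) has_integral
      (integral {- pi..pi} (\<lambda>x. h x * h (x + t)) + integral {- pi..pi} (\<lambda>x. h x * h (x + - t)) -
      2 * cos t * integral {- pi..pi} (\<lambda>x. h x * h (x + 0))) / sin t) {-pi..pi}"
      by (intro has_integral_divide has_integral_diff has_integral_add has_integral_mult_right
         integrable_integral int continuous_intros h')
    then show "((\<lambda>x. h x * (h (x + t) + h (x - t) - 2 * cos t * h x) / sin t) has_integral
      (integral {- pi..pi} (\<lambda>x. h x * h (x + t)) + integral {- pi..pi} (\<lambda>x. h x * h (x + - t)) -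
      2 * cos t * integral {- pi..pi} (\<lambda>x. h x * h (x + 0))) / sin t) {-pi..pi}"
      by (simp add: algebra_simps)
  qed
  then have I: "sin t * integral {-pi..pi} (edge_term h t) = J t + J (- t) - 2 * cos t * J 0"
    using st by simp
  \<comment> \<open>The number of edges disappears through m t = pi. One factor 1 / (2 pi) averages
    the area over \<phi>, the other normalizes the autocorrelations.\<close>
  have "sin t * t * (1 / (4 * pi\<^sup>2) * integral {-pi..pi} (edge_sum h m))
     = (m * t) * (sin t * integral {-pi..pi} (edge_term h t)) / (4 * pi\<^sup>2)"
    unfolding es by simp
  also have "m * t = pi" using m by (simp add: t)
  also have "pi * (sin t * integral {-pi..pi} (edge_term h t)) / (4 * pi\<^sup>2)
     = 1 / 2 * (1 / (2 * pi) * J t + 1 / (2 * pi) * J (- t)) + - cos t * (1 / (2 * pi) * J 0)"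
    unfolding I by (simp add: power2_eq_square add_divide_distrib diff_divide_distrib)
  finally have "sin t * t * (1 / (4 * pi\<^sup>2) * integral {-pi..pi} (edge_sum h m))
     = 1 / 2 * (1 / (2 * pi) * J t + 1 / (2 * pi) * J (- t)) + - cos t * (1 / (2 * pi) * J 0)" .
  moreover have "1 / 2 * (a n * cos (of_int n * t) + a n * cos (of_int n * - t))
       + - cos t * (a n * cos (of_int n * 0)) = a n * (cos (of_int n * t) - cos t)" for n
    by (simp add: algebra_simps)
  moreover have "((\<lambda>n. 1 / 2 * (a n * cos (of_int n * t) + a n * cos (of_int n * - t))
       + - cos t * (a n * cos (of_int n * 0)))
      has_sum 1 / 2 * (1 / (2 * pi) * J t + 1 / (2 * pi) * J (- t)) + - cos t * (1 / (2 * pi) * J 0)) UNIV"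
    unfolding a_def J_def
    by (rule has_sum_add [OF has_sum_cmult_right [OF has_sum_add] has_sum_cmult_right];
        rule parseval_autocorrelation [OF h per])
  ultimately have "((\<lambda>n. a n * (cos (of_int n * t) - cos t))
      has_sum sin t * t * (1 / (4 * pi\<^sup>2) * integral {-pi..pi} (edge_sum h m))) UNIV"
    by (simp only:)
  then show ?thesis by (simp only: a_def)
qed

lemma area_fourier_origin:
  assumes K: "convex_body K" and K0: "0 \<in> K"
  shows "((\<lambda>n. (1 - (of_int n)\<^sup>2) * (cmod (supp_coeff K n))\<^sup>2) has_sum measure lebesgue K / pi) UNIV"
proof -
  define h where "h = (\<lambda>\<phi>. supp_fun \<phi> K)"
  have h: "continuous_on S h" and per: "h (x + 2 * pi) = h x" for S x
    unfolding h_def using continuous_on_supp_fun [OF K] supp_fun_2pi by auto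
  obtain R where R: "R \<ge> 0" "\<And>x. x \<in> K \<Longrightarrow> norm x \<le> R"
    using convex_body_bounded [OF K] by blast
  \<comment> \<open>The offset 8 makes the area bounds hold for every index of the sequence, not
    only eventually.\<close>
  define t where "t = (\<lambda>m::nat. pi / real (m + 8))"
  define A where "A = (\<lambda>m::nat. integral {-pi..pi} (edge_sum h (m + 8)))"
  define \<delta> where "\<delta> = (\<lambda>m. 2 * t m * (4 * R + 2))"
  have t0: "t m > 0" for m by (simp add: t_def)
  have t_lim: "t \<longlonglongrightarrow> 0"
    unfolding t_def using LIMSEQ_ignore_initial_segment [OF lim_const_over_n [of pi], of 8] by simp
  have int: "edge_sum h (m + 8) integrable_on {-pi..pi}" for m
    by (intro integrable_continuous_interval continuous_on_edge_sum h) simp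
  have "decseq \<delta>"
    unfolding \<delta>_def t_def decseq_def using R by (auto intro!: mult_right_mono divide_left_mono)
  moreover have "\<delta> \<longlonglongrightarrow> 0"
    unfolding \<delta>_def by (rule tendsto_eq_intros t_lim refl)+ simp
  ultimately have lim: "(\<lambda>m. measure lebesgue (neighbourhood (\<delta> m) K)) \<longlonglongrightarrow> measure lebesgue K"
    by (intro measure_neighbourhood_tendsto K)
  have lower: "measure lebesgue K \<le> A m / (2 * pi)" for m
  proof -
    have "integral {-pi..pi} (\<lambda>x::real. measure lebesgue K) \<le> A m"
      unfolding A_def using int measure_le_edge_sum(1) [OF K K0 R(2), of "m + 8"]
      by (intro integral_le) (auto simp: h_def)
    then show ?thesis by (simp add: field_simps)
  qed
  have upper: "A m / (2 * pi) \<le> measure lebesgue (neighbourhood (\<delta> m) K)" for m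
  proof -
    have "A m \<le> integral {-pi..pi} (\<lambda>x::real. measure lebesgue (neighbourhood (\<delta> m) K))"
      unfolding A_def \<delta>_def using int measure_le_edge_sum(2) [OF K K0 R(2), of "m + 8" "t m"]
      by (intro integral_le) (auto simp: h_def t_def)
    then show ?thesis by (simp add: field_simps)
  qed
  have "(\<lambda>m. A m / (2 * pi)) \<longlonglongrightarrow> measure lebesgue K"
    by (rule tendsto_sandwich [OF _ _ tendsto_const lim]) (auto simp: lower upper)
  then have "(\<lambda>m. 1 / (2 * pi) * (A m / (2 * pi))) \<longlonglongrightarrow> 1 / (2 * pi) * measure lebesgue K"
    by (intro tendsto_intros)
  then have B: "(\<lambda>m. 1 / (4 * pi\<^sup>2) * A m) \<longlonglongrightarrow> measure lebesgue K / (2 * pi)"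
    by (simp add: power2_eq_square)
  have "((\<lambda>n. (1 - (of_int n)\<^sup>2) * (cmod (fourier_coeff (\<lambda>x. of_real (h x)) n))\<^sup>2)
     has_sum 2 * (measure lebesgue K / (2 * pi))) UNIV"
  proof (rule has_sum_one_minus_square [OF _ parseval t0 t_lim B])
    show "((\<lambda>n. (cmod (fourier_coeff (\<lambda>x. of_real (h x)) n))\<^sup>2 * (cos (of_int n * t m) - cos (t m)))
       has_sum sin (t m) * t m * (1 / (4 * pi\<^sup>2) * A m)) UNIV" for m
      unfolding A_def by (rule mean_edge_sum [OF h per]) (auto simp: t_def)
  qed (auto simp: h per)
  then show ?thesis by (simp add: supp_coeff_eq h_def)
qed

lemma supp_fun_translation:
  assumes K: "convex_body K"
  shows "supp_fun \<phi> ((\<lambda>x. x - a) ` K) = supp_fun \<phi> K - unit_dir \<phi> \<bullet> a"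
proof -
  have K': "convex_body ((\<lambda>x. x - a) ` K)"
    using K by (auto simp: convex_body_def compact_translation_subtract convex_translation_subtract)
  show ?thesis
  proof (rule antisym)
    show "supp_fun \<phi> ((\<lambda>x. x - a) ` K) \<le> supp_fun \<phi> K - unit_dir \<phi> \<bullet> a"
      by (rule supp_fun_least [OF K']) (auto simp: inner_diff_right intro: supp_fun_upper [OF K])
    have "supp_fun \<phi> K \<le> supp_fun \<phi> ((\<lambda>x. x - a) ` K) + unit_dir \<phi> \<bullet> a"
      using supp_fun_upper [OF K', of "x - a" \<phi> for x]
      by (intro supp_fun_least [OF K]) (force simp: inner_diff_right)
    then show "supp_fun \<phi> K - unit_dir \<phi> \<bullet> a \<le> supp_fun \<phi> ((\<lambda>x. x - a) ` K)" by simp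
  qed
qed

text \<open>Moving a point of K to the origin changes the support function by a trigonometric
  polynomial of frequencies 1 and -1, exactly where the factor 1 - n^2 vanishes.\<close>

lemma area_fourier:
  assumes K: "convex_body K"
  shows "((\<lambda>n. (1 - (of_int n)\<^sup>2) * (cmod (supp_coeff K n))\<^sup>2) has_sum measure lebesgue K / pi) UNIV"
proof -
  obtain a where a: "a \<in> K" using K by (auto simp: convex_body_def)
  define K' where "K' = (\<lambda>x. x - a) ` K"
  have K': "convex_body K'" "0 \<in> K'"
    using K a by (auto simp: K'_def convex_body_def compact_translation_subtract convex_translation_subtract)
  have "measure lebesgue K' = measure lebesgue K"
    using measure_translation [of "- a" K] by (simp add: K'_def)
  moreover have "(1 - (of_int n)\<^sup>2) * (cmod (supp_coeff K' n))\<^sup>2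
     = (1 - (of_int n)\<^sup>2) * (cmod (supp_coeff K n))\<^sup>2" for n
  proof (cases "n = 1 \<or> n = -1")
    case False
    \<comment> \<open>With a = (a1, a2), the function - (a1 cos \<phi> + a2 sin \<phi>) has
      coefficient - (a1 - i a2) / 2 at frequency 1 and its conjugate at -1.\<close>
    define b where "b = (\<lambda>n::int. if n = 1 then - Complex (a $ 1 / 2) (- a $ 2 / 2)
        else - Complex (a $ 1 / 2) (a $ 2 / 2))"
    have tr: "complex_of_real (- (unit_dir \<phi> \<bullet> a)) = trig_sum {1, -1} b \<phi>" for \<phi>
      by (simp add: trig_sum_def b_def expi_cis inner_vec2 complex_eq_iff field_simps)
    have "supp_coeff K' n = fourier_coeff (\<lambda>\<phi>. of_real (supp_fun \<phi> K) + trig_sum {1, -1} b \<phi>) n"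
      unfolding supp_coeff_eq K'_def supp_fun_translation [OF K] tr [symmetric] by simp
    also have "\<dots> = supp_coeff K n + fourier_coeff (trig_sum {1, -1} b) n"
      unfolding supp_coeff_eq
      by (intro fourier_coeff_add continuous_intros continuous_on_supp_fun K)
    also have "fourier_coeff (trig_sum {1, -1} b) n = 0"
      using False by (subst fourier_coeff_trig_sum) auto
    finally show ?thesis by simp
  qed auto
  ultimately show ?thesis using area_fourier_origin [OF K'] by (simp only:)
qed

section \<open>The excluded body\<close>

lemma inner_rot: "unit_dir \<phi> \<bullet> rot \<theta> x = unit_dir (\<phi> - \<theta>) \<bullet> x"
  by (simp add: inner_vec2 rot_def matrix_vector_mult_def sum_2 cos_diff sin_diff algebra_simps)

lemma linear_rot: "linear (rot \<theta>)"
  unfolding rot_def by (rule matrix_vector_mul_linear)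

lemma convex_body_excluded:
  assumes "convex_body M"
  shows "convex_body (minkowski_diff M (rot \<theta> ` M))"
proof -
  have M: "M \<noteq> {}" "compact M" "convex M" using assms by (auto simp: convex_body_def)
  have eq: "minkowski_diff A B = (\<Union>x\<in>A. \<Union>y\<in>B. {x - y})" for A B
    by (auto simp: minkowski_diff_def)
  have "compact (minkowski_diff M (rot \<theta> ` M))"
    unfolding minkowski_diff_def using M
    by (intro compact_differences compact_continuous_image linear_continuous_on
        linear_conv_bounded_linear [THEN iffD1] linear_rot)
  moreover have "convex (minkowski_diff M (rot \<theta> ` M))"
    unfolding eq using M by (intro convex_differences convex_linear_image linear_rot)
  ultimately show ?thesis using M by (auto simp: convex_body_def minkowski_diff_def)
qed

text \<open>The two points of a difference vary independently, so the maximum splits; moved to the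
  direction, the rotation turns it by -\<theta> and the minus sign by pi.\<close>

lemma supp_fun_excluded:
  assumes M: "convex_body M"
  shows "supp_fun \<phi> (minkowski_diff M (rot \<theta> ` M)) = supp_fun \<phi> M + supp_fun (\<phi> + (pi - \<theta>)) M"
proof (rule antisym)
  note K = convex_body_excluded [OF M, of \<theta>]
  have inner: "unit_dir \<phi> \<bullet> (x - rot \<theta> y) = unit_dir \<phi> \<bullet> x + unit_dir (\<phi> + (pi - \<theta>)) \<bullet> y" for x y
    using unit_dir_pi [of "\<phi> - \<theta>"] by (simp add: inner_diff_right inner_rot algebra_simps)
  show "supp_fun \<phi> (minkowski_diff M (rot \<theta> ` M)) \<le> supp_fun \<phi> M + supp_fun (\<phi> + (pi - \<theta>)) M"
    by (rule supp_fun_least [OF K])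
      (auto simp: minkowski_diff_def inner intro!: add_mono supp_fun_upper [OF M])
  obtain x where x: "x \<in> M" "supp_fun \<phi> M = unit_dir \<phi> \<bullet> x"
    using supp_fun_attained [OF M] .
  obtain y where y: "y \<in> M" "supp_fun (\<phi> + (pi - \<theta>)) M = unit_dir (\<phi> + (pi - \<theta>)) \<bullet> y"
    using supp_fun_attained [OF M] .
  show "supp_fun \<phi> M + supp_fun (\<phi> + (pi - \<theta>)) M \<le> supp_fun \<phi> (minkowski_diff M (rot \<theta> ` M))"
    unfolding x(2) y(2) inner [symmetric]
    using x(1) y(1) by (intro supp_fun_upper [OF K]) (auto simp: minkowski_diff_def)
qed

lemma supp_coeff_excluded:
  assumes M: "convex_body M"
  shows "(cmod (supp_coeff (minkowski_diff M (rot \<theta> ` M)) n))\<^sup>2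
    = 2 * ((1 + (-1) powi n * cos (of_int n * \<theta>)) * (cmod (supp_coeff M n))\<^sup>2)"
proof -
  define H where "H = (\<lambda>\<phi>. complex_of_real (supp_fun \<phi> M))"
  have H: "continuous_on S H" "continuous_on S (\<lambda>x. H (x + c))" for S c
    unfolding H_def
    by (auto intro!: continuous_intros continuous_on_supp_fun M
        continuous_on_compose2 [OF continuous_on_supp_fun [OF M, of UNIV]])
  have per: "H (\<phi> + 2 * pi) = H \<phi>" for \<phi> by (simp add: H_def supp_fun_2pi)
  have "supp_coeff (minkowski_diff M (rot \<theta> ` M)) n
     = fourier_coeff (\<lambda>\<phi>. H \<phi> + H (\<phi> + (pi - \<theta>))) n"
    by (simp add: supp_coeff_eq supp_fun_excluded [OF M] H_def)
  also have "\<dots> = fourier_coeff H n + expi n (pi - \<theta>) * fourier_coeff H n"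
    using fourier_coeff_shift [OF H(1) per] by (simp add: fourier_coeff_add H)
  also have "\<dots> = (1 + expi n (pi - \<theta>)) * supp_coeff M n"
    by (simp add: supp_coeff_eq H_def algebra_simps)
  finally have "(cmod (supp_coeff (minkowski_diff M (rot \<theta> ` M)) n))\<^sup>2
    = (2 + 2 * cos (of_int n * (pi - \<theta>))) * (cmod (supp_coeff M n))\<^sup>2"
    by (simp only: norm_mult power_mult_distrib norm_one_plus_expi)
  \<comment> \<open>sin (n pi) = 0 leaves one product of the addition formula, and cos (n pi) is the
    sign.\<close>
  also have "cos (of_int n * (pi - \<theta>)) = (-1) powi n * cos (of_int n * \<theta>)"
    using cos_npi_int [of n] sin_npi_int [of n]
    by (simp add: right_diff_distrib cos_diff mult.commute [of pi] power_int_minus_left)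
  finally show ?thesis by (simp add: algebra_simps)
qed

theorem lemma2p1:
  fixes M :: "(real^2) set" and \<theta> :: real
  assumes "convex_body M"
  shows "(\<lambda>n::int. (1 - (of_int n)\<^sup>2) * (1 + (-1) powi n * cos (of_int n * \<theta>)) *
            (cmod (supp_coeff M n))\<^sup>2) summable_on UNIV \<and>
         excluded_area \<theta> M =
          2 * pi * (\<Sum>\<^sub>\<infinity>n::int. (1 - (of_int n)\<^sup>2) * (1 + (-1) powi n * cos (of_int n * \<theta>)) *
            (cmod (supp_coeff M n))\<^sup>2)"
proof -
  \<comment> \<open>The factor 1 / 2 cancels the 2 of \<open>supp_coeff_excluded\<close>; the single
    \<open>has_sum\<close> then contains both the summability and the value.\<close>
  have "((\<lambda>n. 1 / 2 * ((1 - (of_int n)\<^sup>2) * (cmod (supp_coeff (minkowski_diff M (rot \<theta> ` M)) n))\<^sup>2))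
      has_sum 1 / 2 * (excluded_area \<theta> M / pi)) UNIV"
    unfolding excluded_area_def
    by (intro has_sum_cmult_right area_fourier convex_body_excluded assms)
  then have "((\<lambda>n::int. (1 - (of_int n)\<^sup>2) * (1 + (-1) powi n * cos (of_int n * \<theta>)) *
            (cmod (supp_coeff M n))\<^sup>2) has_sum excluded_area \<theta> M / (2 * pi)) UNIV"
    unfolding supp_coeff_excluded [OF assms] by (simp add: mult.assoc)
  then show ?thesis
    by (auto simp: has_sum_imp_summable infsumI)
qed

end
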